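(* Let $\mathscr{A}=\{-1,1\}$, $\Omega=\mathscr{A}^{\mathbb{N}}$, $\varepsilon>0$, and let $f:\Omega\to\mathbb{R}$ be the potential of the long-range Ising model with $1/r^{2+\varepsilon}$ interaction energy, $$f(x)=\sum_{n\ge2}\frac{x_1x_n}{(n-1)^{2+\varepsilon}}.$$ Then $f$ belongs to the Walters space $W(\Omega)$, and the model has a unique DLR-Gibbs measure, i.e. $\mathcal{G}^{DLR}(f)$ has exactly one element.
   Context: $\mathbb{N}=\{1,2,\dots\}$; $\Omega=\mathscr{A}^{\mathbb{N}}$ carries the metric $d(x,y)=2^{-N}$, $N=\inf\{i: x_i\neq y_i\}$ (with $d(x,x)=0$), and Borel $\sigma$-algebra $\mathscr{F}$; $\sigma:\Omega\to\Omega$ is the left shift; $\mathcal{P}(\Omega)$ is the set of Borel probability measures on $\Omega$. Walters space: $\mathrm{var}_n(f)=\sup\{|f(x)-f(y)|: x_i=y_i \text{ for all } 1\le i\le n\}$ and $S_n(f)=f+f\circ\sigma+\dots+f\circ\sigma^{n-1}$. $W(\Omega)$ is the set of $f:\Omega\to\mathbb{R}$ with $\lim_{p\to\infty}\sup_{n\ge1}\mathrm{var}_{n+p}(S_n(f))=0$. Kernels: for continuous $f$ and $n\in\mathbb{N}$ put $H_n(x)=S_n(f)(x)$ and, for $F\in\mathscr{F}$, $y\in\Omega$, $$K_n(F,y)=\frac{1}{Z_n^y}\sum_{x\in\Omega:\ \sigma^n(x)=\sigma^n(y)}1_F(x)\exp(H_n(x)),\qquad Z_n^y=\sum_{x\in\Omega:\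 \sigma^n(x)=\sigma^n(y)}\exp(H_n(x)).$$ DLR-Gibbs measures: let $\mathcal{T}_n$ be the $\sigma$-algebra generated by the coordinate projections $\pi_j:\Omega\to\mathscr{A}$, $j\ge n+1$. Then $\mathcal{G}^{DLR}(f)$ is the set of $\mu\in\mathcal{P}(\Omega)$ such that for all $F\in\mathscr{F}$ and all $n\in\mathbb{N}$, $\mu(F|\mathcal{T}_n)(y)=K_n(F,y)$ for $\mu$-almost every $y$. *)

theory Defs
  imports "HOL-Probability.Probability"
begin

section \<open>The configuration space\<close>

text \<open>Configurations are indexed by the positive integers. They are the extensional functions on
  \<open>{1..}\<close> (with the value \<open>undefined\<close> at \<open>0\<close>), so that equality of functions is equality of
  configurations.\<close>

definition spins :: "real set" where
  "spins = {-1, 1}"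

definition Omega :: "(nat \<Rightarrow> real) set" where
  "Omega = {1..} \<rightarrow>\<^sub>E spins"

definition config_dist :: "(nat \<Rightarrow> real) \<Rightarrow> (nat \<Rightarrow> real) \<Rightarrow> real" where
  "config_dist x y = (if x = y then 0 else (1 / 2) ^ Inf {i. 1 \<le> i \<and> x i \<noteq> y i})"

definition Borel_Omega :: "(nat \<Rightarrow> real) measure" where
  "Borel_Omega = sigma Omega {U. openin (Metric_space.mtopology Omega config_dist) U}"

definition left_shift :: "(nat \<Rightarrow> real) \<Rightarrow> nat \<Rightarrow> real" where
  "left_shift x = (\<lambda>i\<in>{1..}. x (i + 1))"

definition prob_measures :: "(nat \<Rightarrow> real) measure set" where
  "prob_measures = {\<mu>. prob_space \<mu> \<and> sets \<mu> = sets Borel_Omega}"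

section \<open>The Walters space\<close>

definition birkhoff_sum :: "nat \<Rightarrow> ((nat \<Rightarrow> real) \<Rightarrow> real) \<Rightarrow> (nat \<Rightarrow> real) \<Rightarrow> real" where
  "birkhoff_sum n f x = (\<Sum>k<n. f ((left_shift ^^ k) x))"

text \<open>The suprema may be infinite, hence the extended reals.\<close>

definition variation :: "nat \<Rightarrow> ((nat \<Rightarrow> real) \<Rightarrow> real) \<Rightarrow> ereal" where
  "variation n f =
     Sup {ereal \<bar>f x - f y\<bar> | x y. x \<in> Omega \<and> y \<in> Omega \<and> (\<forall>i. 1 \<le> i \<and> i \<le> n \<longrightarrow> x i = y i)}"

definition Walters :: "((nat \<Rightarrow> real) \<Rightarrow> real) set" where
  "Walters = {f. (\<lambda>p. SUP n\<in>{1..}. variation (n + p) (birkhoff_sum n f)) \<longlonglongrightarrow> 0}"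

section \<open>DLR-Gibbs measures\<close>

definition fibre :: "nat \<Rightarrow> (nat \<Rightarrow> real) \<Rightarrow> (nat \<Rightarrow> real) set" where
  "fibre n y = {x \<in> Omega. (left_shift ^^ n) x = (left_shift ^^ n) y}"

definition partition_function :: "((nat \<Rightarrow> real) \<Rightarrow> real) \<Rightarrow> nat \<Rightarrow> (nat \<Rightarrow> real) \<Rightarrow> real" where
  "partition_function f n y = (\<Sum>x\<in>fibre n y. exp (birkhoff_sum n f x))"

definition kernel ::
    "((nat \<Rightarrow> real) \<Rightarrow> real) \<Rightarrow> nat \<Rightarrow> (nat \<Rightarrow> real) set \<Rightarrow> (nat \<Rightarrow> real) \<Rightarrow> real" where
  "kernel f n F y =
     1 / partition_function f n y * (\<Sum>x\<in>fibre n y. indicator F x * exp (birkhoff_sum n f x))"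

definition tail_algebra :: "nat \<Rightarrow> (nat \<Rightarrow> real) measure" where
  "tail_algebra n = sigma Omega {{x \<in> Omega. x j \<in> B} | j B. n + 1 \<le> j \<and> B \<subseteq> spins}"

definition DLR_Gibbs :: "((nat \<Rightarrow> real) \<Rightarrow> real) \<Rightarrow> (nat \<Rightarrow> real) measure set" where
  "DLR_Gibbs f = {\<mu> \<in> prob_measures. \<forall>F \<in> sets Borel_Omega. \<forall>n\<ge>1.
     AE y in \<mu>. real_cond_exp \<mu> (tail_algebra n) (indicator F) y = kernel f n F y}"

section \<open>The long-range Ising potential\<close>

definition ising_potential :: "real \<Rightarrow> (nat \<Rightarrow> real) \<Rightarrow> real" where
  "ising_potential \<epsilon> x = (\<Sum>\<^sub>\<infinity>n\<in>{2..}. x 1 * x n / (real n - 1) powr (2 + \<epsilon>))"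

section \<open>Well-definedness\<close>

text \<open>The library operations used above are given default values outside their intended domains:
  \<^const>\<open>Metric_space.mtopology\<close> is meaningful for metrics, \<^const>\<open>real_cond_exp\<close> for
  sub-sigma-algebras, sums over sets for finite sets, and infinite sums for summable families.
  The following facts show that none of these defaults is used.\<close>

lemma config_dist_ge:
  assumes "1 \<le> j" "x j \<noteq> y j"
  shows "(1 / 2) ^ j \<le> config_dist x y"
proof -
  have "Inf {i. 1 \<le> i \<and> x i \<noteq> y i} \<le> j"
    using assms by (intro cInf_lower) auto
  then show ?thesis
    using assms by (auto simp: config_dist_def intro!: power_decreasing)
qed

lemma first_difference:
  assumes "x \<in> Omega" "y \<in> Omega" "x \<noteq> y"
  obtains N where "1 \<le> N" "x N \<noteq> y N" "config_dist x y = (1 / 2) ^ N"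
proof -
  have "\<exists>i\<in>{1..}. x i \<noteq> y i"
    using assms PiE_ext[of x "{1..}" "\<lambda>_. spins" y] by (auto simp: Omega_def)
  then have "{i. 1 \<le> i \<and> x i \<noteq> y i} \<noteq> {}" by auto
  from Inf_nat_def1[OF this] show thesis
    using assms that by (auto simp: config_dist_def)
qed

lemma Metric_space_Omega: "Metric_space Omega config_dist"
proof
  fix x y z
  show "0 \<le> config_dist x y" by (simp add: config_dist_def)
  have "{i. 1 \<le> i \<and> x i \<noteq> y i} = {i. 1 \<le> i \<and> y i \<noteq> x i}" by auto
  then show "config_dist x y = config_dist y x" by (cases "x = y") (auto simp: config_dist_def)
  assume x: "x \<in> Omega" and y: "y \<in> Omega"
  show "config_dist x y = 0 \<longleftrightarrow> x = y" by (simp add: config_dist_def)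
  assume z: "z \<in> Omega"
  show "config_dist x z \<le> config_dist x y + config_dist y z"
  proof (cases "x = z")
    case True
    then show ?thesis by (simp add: config_dist_def)
  next
    case False
    then obtain N where N: "1 \<le> N" "x N \<noteq> z N" "config_dist x z = (1 / 2) ^ N"
      using first_difference x z by blast
    have nn: "0 \<le> config_dist x y" "0 \<le> config_dist y z" by (simp_all add: config_dist_def)
    from N have "x N \<noteq> y N \<or> y N \<noteq> z N" by auto
    then show ?thesis
      using config_dist_ge[of N x y] config_dist_ge[of N y z] N nn by linarith
  qed
qed

lemma open_sets_Pow: "{U. openin (Metric_space.mtopology Omega config_dist) U} \<subseteq> Pow Omega"
  using openin_subset[of "Metric_space.mtopology Omega config_dist"]
  by (auto simp: Metric_space.topspace_mtopology[OF Metric_space_Omega])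

lemma space_Borel_Omega: "space Borel_Omega = Omega"
  unfolding Borel_Omega_def by (rule space_measure_of[OF open_sets_Pow])

lemma openin_coordinate:
  assumes "1 \<le> j"
  shows "openin (Metric_space.mtopology Omega config_dist) {x \<in> Omega. x j \<in> B}"
  unfolding Metric_space.openin_mtopology[OF Metric_space_Omega]
proof (intro conjI allI impI)
  fix x assume x: "x \<in> {x \<in> Omega. x j \<in> B}"
  have "Metric_space.mball Omega config_dist x ((1 / 2) ^ j) \<subseteq> {x \<in> Omega. x j \<in> B}"
  proof
    fix y assume "y \<in> Metric_space.mball Omega config_dist x ((1 / 2) ^ j)"
    then have "y \<in> Omega" "config_dist x y < (1 / 2) ^ j"
      by (simp_all add: Metric_space.in_mball[OF Metric_space_Omega])
    moreover from this have "x j = y j" using config_dist_ge[OF assms, of x y] by linarith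
    ultimately show "y \<in> {x \<in> Omega. x j \<in> B}" using x by auto
  qed
  then show "\<exists>r>0. Metric_space.mball Omega config_dist x r \<subseteq> {x \<in> Omega. x j \<in> B}"
    by (intro exI[of _ "(1 / 2) ^ j"]) simp
qed auto

lemma subalgebra_tail_algebra:
  assumes "\<mu> \<in> prob_measures"
  shows "subalgebra \<mu> (tail_algebra n)"
proof -
  have sets: "sets \<mu> = sets Borel_Omega" using assms by (simp add: prob_measures_def)
  from sets_eq_imp_space_eq[OF this] have space: "space \<mu> = Omega"
    by (simp only: space_Borel_Omega)
  have gen: "{{x \<in> Omega. x j \<in> B} | j B. n + 1 \<le> j \<and> B \<subseteq> spins} \<subseteq> sets Borel_Omega"
  proof clarify
    fix j B assume "n + 1 \<le> j"
    then have "openin (Metric_space.mtopology Omega config_dist) {x \<in> Omega. x j \<in> B}"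
      by (intro openin_coordinate) simp
    then show "{x \<in> Omega. x j \<in> B} \<in> sets Borel_Omega"
      unfolding Borel_Omega_def sets_measure_of[OF open_sets_Pow] by blast
  qed
  have sub: "{{x \<in> Omega. x j \<in> B} | j B. n + 1 \<le> j \<and> B \<subseteq> spins} \<subseteq> Pow Omega" by auto
  have "sets (tail_algebra n) \<subseteq> sets Borel_Omega"
    unfolding tail_algebra_def sets_measure_of[OF sub]
    using sets.sigma_sets_subset[OF gen] by (simp only: space_Borel_Omega)
  moreover have "space (tail_algebra n) = Omega"
    unfolding tail_algebra_def by (rule space_measure_of[OF sub])
  ultimately show ?thesis by (simp add: subalgebra_def sets space)
qed

lemma left_shift_funpow: "1 \<le> i \<Longrightarrow> (left_shift ^^ n) x i = x (i + n)"
  by (induction n arbitrary: i) (auto simp: left_shift_def)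

lemma left_shift_in_Omega: "x \<in> Omega \<Longrightarrow> left_shift x \<in> Omega"
  by (auto simp: Omega_def left_shift_def PiE_iff)

lemma finite_fibre: "finite (fibre n y)"
proof (rule inj_on_finite)
  show "inj_on (\<lambda>x. restrict x {1..n}) (fibre n y)"
  proof (rule inj_onI)
    fix x z assume x: "x \<in> fibre n y" and z: "z \<in> fibre n y"
      and eq: "restrict x {1..n} = restrict z {1..n}"
    have "x i = z i" if i: "1 \<le> i" for i
    proof (cases "i \<le> n")
      case True
      then show ?thesis using fun_cong[OF eq, of i] i by simp
    next
      case False
      then have "1 \<le> i - n" "i - n + n = i" by auto
      moreover have "(left_shift ^^ n) x (i - n) = (left_shift ^^ n) z (i - n)"
        using x z by (simp add: fibre_def)
      ultimately show ?thesis by (simp add: left_shift_funpow)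
    qed
    then show "x = z"
      using x z by (intro PiE_ext[of x "{1..}" "\<lambda>_. spins" z]) (auto simp: fibre_def Omega_def)
  qed
  show "(\<lambda>x. restrict x {1..n}) ` fibre n y \<subseteq> {1..n} \<rightarrow>\<^sub>E spins"
    by (auto simp: fibre_def Omega_def)
  show "finite ({1..n} \<rightarrow>\<^sub>E spins)"
    by (intro finite_PiE) (auto simp: spins_def)
qed

lemma summable_ising:
  assumes "\<epsilon> > 0" "x \<in> Omega"
  shows "(\<lambda>n. x 1 * x n / (real n - 1) powr (2 + \<epsilon>)) summable_on {2..}"
proof -
  have "summable (\<lambda>n. real n powr (- (2 + \<epsilon>)))"
    using assms by (subst summable_real_powr_iff) simp
  then have "(\<lambda>n. real n powr (- (2 + \<epsilon>))) summable_on UNIV"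
    by (intro norm_summable_imp_summable_on) simp
  then have "(\<lambda>n. real n powr (- (2 + \<epsilon>))) summable_on {1..}"
    by (rule summable_on_subset_banach) simp
  moreover have "bij_betw (\<lambda>n::nat. n - 1) {2..} {1..}"
    by (rule bij_betw_byWitness[where f' = Suc]) auto
  ultimately have "(\<lambda>n. real (n - 1) powr (- (2 + \<epsilon>))) summable_on {2..}"
    using summable_on_reindex_bij_betw[of "\<lambda>n. n - 1" "{2..}" "{1..}"
        "\<lambda>n. real n powr (- (2 + \<epsilon>))"] by blast
  then have "(\<lambda>n. norm (x 1 * x n / (real n - 1) powr (2 + \<epsilon>))) summable_on {2..}"
  proof (rule Infinite_Sum.abs_summable_on_comparison_test')
    fix n :: nat assume n: "n \<in> {2..}"
    have "x i \<in> spins" if "1 \<le> i" for i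
      using assms that by (auto simp: Omega_def)
    from this[of 1] this[of n] n have "\<bar>x 1\<bar> = 1" "\<bar>x n\<bar> = 1"
      by (auto simp: spins_def)
    moreover have "real (n - 1) = real n - 1" using n by simp
    ultimately show "norm (x 1 * x n / (real n - 1) powr (2 + \<epsilon>)) \<le> real (n - 1) powr (- (2 + \<epsilon>))"
      unfolding powr_minus by (simp add: abs_mult inverse_eq_divide)
  qed
  then show ?thesis by (rule abs_summable_summable)
qed

end

theory Submission
  imports Defs
begin

text \<open>
  In one dimension with \<open>1/r^(2 + \<epsilon>)\<close> interactions, the energy between the two sides of a cut is finite:
  \<open>r\<close> bonds of length \<open>r\<close> cross the cut, and the sum of \<open>r * r powr (- (2 + \<epsilon>))\<close> converges. Changing
  a configuration beyond coordinate \<open>n + p\<close> thus changes its \<open>n\<close>-th Birkhoff sum by at most a tail of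
  this series, uniformly in \<open>n\<close> (\<open>ising_birkhoff_sum_diff\<close>). This is membership in the Walters space,
  and everything else follows from this bounded distortion alone.

  The weights that two boundary conditions give to the same initial word differ at most by a constant
  factor. Averaging over a fibre therefore contracts the oscillation of a function that depends
  on the averaged coordinates only (\<open>gibbs_avg_difference\<close>, \<open>oscillation_step\<close>). Averages of continuous
  functions are again continuous (\<open>unif_cont_gibbs_avg\<close>), hence nearly of this kind, and the kernels are
  consistent (\<open>gibbs_avg_consistent\<close>), so the contraction can be iterated: the averages of a continuous
  function over longer and longer fibres converge uniformly to a constant, whatever the boundary
  condition (\<open>oscillation_tends_to_zero\<close>, \<open>limit_avg\<close>).

  A Gibbs measure is invariant under the kernels, so it gives each cylinder event the limiting
  constant, which proves uniqueness. Conversely the limiting constants are finitely additive on cylinder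
  events, extend to a measure by compactness, and are invariant under the kernels; as the kernels
  leave tail events alone, this measure is Gibbs (\<open>limit_measure_exists\<close>, \<open>DLR_Gibbs_eq\<close>).
\<close>

section \<open>Configurations and cylinder events\<close>

definition agree :: "nat \<Rightarrow> (nat \<Rightarrow> real) \<Rightarrow> (nat \<Rightarrow> real) \<Rightarrow> bool" where
  "agree n x y \<longleftrightarrow> (\<forall>i. 1 \<le> i \<and> i \<le> n \<longrightarrow> x i = y i)"

text \<open>The configurations of a fibre of the \<open>n\<close>-th iterate of the shift differ only in their first \<open>n\<close>
  coordinates. Gluing these to another tail identifies any two fibres, so that averages over
  different fibres become weighted means over one index set.\<close>

definition glue :: "nat \<Rightarrow> (nat \<Rightarrow> real) \<Rightarrow> (nat \<Rightarrow> real) \<Rightarrow> nat \<Rightarrow> real" where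
  "glue n x y = (\<lambda>i. if i \<le> n then x i else y i)"

definition plus_config :: "nat \<Rightarrow> real" where
  "plus_config = (\<lambda>i\<in>{1..}. 1)"

text \<open>Cylinder events are described by their invariance, not by the words that span them: closure
  under the Boolean operations, openness and closedness can then be read off directly.\<close>

definition cylinders :: "(nat \<Rightarrow> real) set set" where
  "cylinders = {A. A \<subseteq> Omega \<and> (\<exists>n. \<forall>x\<in>A. \<forall>y\<in>Omega. agree n x y \<longrightarrow> y \<in> A)}"

lemma plus_config_in_Omega: "plus_config \<in> Omega"
  by (auto simp: plus_config_def Omega_def spins_def)

lemma Omega_eqI:
  assumes "x \<in> Omega" "y \<in> Omega" "\<And>i. 1 \<le> i \<Longrightarrow> x i = y i"
  shows "x = y"
  using assms by (intro PiE_ext[of x "{1..}" "\<lambda>_. spins" y]) (auto simp: Omega_def)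

lemma Omega_spin: "x \<in> Omega \<Longrightarrow> 1 \<le> i \<Longrightarrow> x i \<in> spins"
  by (auto simp: Omega_def)

lemma Omega_zero: "x \<in> Omega \<Longrightarrow> x 0 = undefined"
  by (auto simp: Omega_def PiE_iff extensional_def)

lemma glue_in_Omega: "x \<in> Omega \<Longrightarrow> y \<in> Omega \<Longrightarrow> glue n x y \<in> Omega"
  by (auto simp: Omega_def glue_def PiE_iff extensional_def)

lemma agree_sym: "agree n x y \<Longrightarrow> agree n y x"
  by (auto simp: agree_def)

lemma agree_mono: "agree n x y \<Longrightarrow> m \<le> n \<Longrightarrow> agree m x y"
  by (auto simp: agree_def)

lemma agree_trans: "agree n x y \<Longrightarrow> agree n y z \<Longrightarrow> agree n x z"
  by (auto simp: agree_def)

lemma agree_glue: "agree n x (glue n x y)"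
  by (auto simp: agree_def glue_def)

lemma left_shift_funpow_in_Omega: "x \<in> Omega \<Longrightarrow> (left_shift ^^ n) x \<in> Omega"
  by (induction n) (auto intro: left_shift_in_Omega)

lemma fibre_iff:
  assumes "y \<in> Omega"
  shows "x \<in> fibre n y \<longleftrightarrow> x \<in> Omega \<and> (\<forall>i>n. x i = y i)"
proof (intro iffI conjI allI impI)
  assume x: "x \<in> fibre n y"
  then show "x \<in> Omega" by (simp add: fibre_def)
  fix i assume "n < i"
  then have "1 \<le> i - n" "i - n + n = i" by auto
  moreover have "(left_shift ^^ n) x (i - n) = (left_shift ^^ n) y (i - n)"
    using x by (simp add: fibre_def)
  ultimately show "x i = y i" by (simp add: left_shift_funpow)
next
  assume x: "x \<in> Omega \<and> (\<forall>i>n. x i = y i)"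
  have "(left_shift ^^ n) x = (left_shift ^^ n) y"
    using x assms by (intro Omega_eqI) (auto simp: left_shift_funpow left_shift_funpow_in_Omega)
  with x show "x \<in> fibre n y" by (simp add: fibre_def)
qed

lemma fibre_subset: "fibre n y \<subseteq> Omega"
  by (auto simp: fibre_def)

lemma self_in_fibre: "y \<in> Omega \<Longrightarrow> y \<in> fibre n y"
  by (simp add: fibre_def)

lemma fibre_cong: "x \<in> fibre n y \<Longrightarrow> fibre n x = fibre n y"
  by (simp add: fibre_def)

lemma fibre_mono:
  assumes "y \<in> Omega" "m \<le> n" "x \<in> fibre n y"
  shows "fibre m x \<subseteq> fibre n y"
proof -
  have "x \<in> Omega" using assms fibre_subset by auto
  then show ?thesis using assms by (auto simp: fibre_iff)
qed

lemma bij_betw_glue: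
  assumes "u \<in> Omega" "v \<in> Omega"
  shows "bij_betw (\<lambda>x. glue n x v) (fibre n u) (fibre n v)"
proof (rule bij_betw_byWitness[where f' = "\<lambda>x. glue n x u"])
  show "\<forall>x\<in>fibre n u. glue n (glue n x v) u = x"
    using assms by (auto simp: fibre_iff glue_def fun_eq_iff)
  show "\<forall>x\<in>fibre n v. glue n (glue n x u) v = x"
    using assms by (auto simp: fibre_iff glue_def fun_eq_iff)
qed (use assms in \<open>auto simp: fibre_iff glue_in_Omega\<close>, auto simp: glue_def)

lemma sum_fibre_glue:
  assumes "u \<in> Omega" "v \<in> Omega"
  shows "sum h (fibre n v) = (\<Sum>x\<in>fibre n u. h (glue n x v))"
  using sum.reindex_bij_betw[OF bij_betw_glue[OF assms, of n], of h] by simp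

lemma cylindersI:
  assumes "A \<subseteq> Omega" "\<And>x y. x \<in> A \<Longrightarrow> y \<in> Omega \<Longrightarrow> agree n x y \<Longrightarrow> y \<in> A"
  shows "A \<in> cylinders"
  using assms by (auto simp: cylinders_def)

lemma algebra_cylinders: "algebra Omega cylinders"
  unfolding algebra_iff_Un
proof (intro conjI ballI)
  show "cylinders \<subseteq> Pow Omega" by (auto simp: cylinders_def)
  show "{} \<in> cylinders" by (auto simp: cylinders_def)
  fix A assume A: "A \<in> cylinders"
  then obtain n where n: "A \<subseteq> Omega" "\<And>x y. x \<in> A \<Longrightarrow> y \<in> Omega \<Longrightarrow> agree n x y \<Longrightarrow> y \<in> A"
    unfolding cylinders_def by blast
  show "Omega - A \<in> cylinders"
    using n agree_sym by (intro cylindersI[of _ n]) blast+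
  fix B assume "B \<in> cylinders"
  then obtain m where m: "B \<subseteq> Omega" "\<And>x y. x \<in> B \<Longrightarrow> y \<in> Omega \<Longrightarrow> agree m x y \<Longrightarrow> y \<in> B"
    unfolding cylinders_def by blast
  show "A \<union> B \<in> cylinders"
  proof (rule cylindersI[of _ "max n m"])
    fix x y assume "x \<in> A \<union> B" "y \<in> Omega" "agree (max n m) x y"
    then show "y \<in> A \<union> B"
      using n(2) m(2) agree_mono[of "max n m" x y n] agree_mono[of "max n m" x y m] by auto
  qed (use n m in auto)
qed

lemma agree_in_cylinders: "{x \<in> Omega. P x} \<in> cylinders"
  if "\<And>x y. x \<in> Omega \<Longrightarrow> y \<in> Omega \<Longrightarrow> agree n x y \<Longrightarrow> P x \<Longrightarrow> P y"
  using that by (intro cylindersI[of _ n]) auto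

text \<open>A point of an open set \<open>U\<close> has a cylinder neighbourhood inside \<open>U\<close>. Collecting the points
  for which \<open>N\<close> coordinates suffice gives one cylinder event for each \<open>N\<close>, hence \<open>U\<close> is a
  countable union of cylinder events.\<close>

lemma open_in_sigma_cylinders:
  assumes "U \<subseteq> Omega" "\<And>x. x \<in> U \<Longrightarrow> \<exists>N. \<forall>y\<in>Omega. agree N x y \<longrightarrow> y \<in> U"
  shows "U \<in> sigma_sets Omega cylinders"
proof -
  define V where "V N = {x \<in> Omega. \<forall>y\<in>Omega. agree N x y \<longrightarrow> y \<in> U}" for N
  have "V N \<in> cylinders" for N
    unfolding V_def by (intro agree_in_cylinders[of N]) (blast intro: agree_trans)
  then have "(\<Union>N. V N) \<in> sigma_sets Omega cylinders"
    by (intro sigma_sets.Union sigma_sets.Basic)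
  moreover have "(\<Union>N. V N) = U"
    using assms by (auto simp: V_def agree_def)
  ultimately show ?thesis by simp
qed

lemma openin_imp_cylinder_nbhd:
  assumes "openin (Metric_space.mtopology Omega config_dist) U" "x \<in> U"
  shows "\<exists>N. \<forall>y\<in>Omega. agree N x y \<longrightarrow> y \<in> U"
proof -
  from assms obtain r where r: "r > 0" "Metric_space.mball Omega config_dist x r \<subseteq> U"
    and U: "U \<subseteq> Omega"
    unfolding Metric_space.openin_mtopology[OF Metric_space_Omega] by blast
  obtain N where N: "(1 / 2 :: real) ^ N < r"
    using real_arch_pow_inv[of r "1 / 2"] r(1) by auto
  have "y \<in> U" if y: "y \<in> Omega" "agree N x y" for y
  proof (cases "x = y")
    case False
    have x: "x \<in> Omega" using assms U by auto
    obtain M where M: "1 \<le> M" "x M \<noteq> y M" "config_dist x y = (1 / 2) ^ M"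
      using first_difference[OF x y(1) False] by blast
    then have "N \<le> M" using y(2) by (force simp: agree_def)
    then have "config_dist x y < r"
      using M(3) N power_decreasing[of N M "1 / 2 :: real"] by linarith
    then show ?thesis
      using r(2) x y(1) by (auto simp: Metric_space.in_mball[OF Metric_space_Omega])
  qed (use assms in auto)
  then show ?thesis by blast
qed

lemma openin_cylinder:
  assumes "A \<in> cylinders"
  shows "openin (Metric_space.mtopology Omega config_dist) A"
proof -
  obtain n where n: "A \<subseteq> Omega" "\<And>x y. x \<in> A \<Longrightarrow> y \<in> Omega \<Longrightarrow> agree n x y \<Longrightarrow> y \<in> A"
    using assms unfolding cylinders_def by blast
  have "Metric_space.mball Omega config_dist x ((1 / 2) ^ n) \<subseteq> A" if "x \<in> A" for x
  proof
    fix y assume "y \<in> Metric_space.mball Omega config_dist x ((1 / 2) ^ n)"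
    then have y: "y \<in> Omega" "config_dist x y < (1 / 2) ^ n"
      by (simp_all add: Metric_space.in_mball[OF Metric_space_Omega])
    have "x i = y i" if "1 \<le> i" "i \<le> n" for i
      using config_dist_ge[OF that(1), of x y] power_decreasing[OF that(2), of "1 / 2 :: real"] y(2)
      by linarith
    then show "y \<in> A" using n(2)[OF \<open>x \<in> A\<close> y(1)] by (simp add: agree_def)
  qed
  then show ?thesis
    unfolding Metric_space.openin_mtopology[OF Metric_space_Omega]
  proof (intro conjI allI impI n(1))
    fix x assume "x \<in> A"
    with \<open>\<And>x. x \<in> A \<Longrightarrow> Metric_space.mball Omega config_dist x ((1 / 2) ^ n) \<subseteq> A\<close>
    show "\<exists>r>0. Metric_space.mball Omega config_dist x r \<subseteq> A"
      by (intro exI[of _ "(1 / 2) ^ n"]) simp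
  qed
qed

lemma sets_Borel_Omega: "sets Borel_Omega = sigma_sets Omega cylinders"
proof -
  have "sets Borel_Omega = sigma_sets Omega {U. openin (Metric_space.mtopology Omega config_dist) U}"
    unfolding Borel_Omega_def by (rule sets_measure_of[OF open_sets_Pow])
  also have "\<dots> = sigma_sets Omega cylinders"
  proof (rule sigma_sets_eqI)
    fix U assume "U \<in> {U. openin (Metric_space.mtopology Omega config_dist) U}"
    then show "U \<in> sigma_sets Omega cylinders"
      using open_sets_Pow openin_imp_cylinder_nbhd by (intro open_in_sigma_cylinders) auto
  next
    fix A assume "A \<in> cylinders"
    then show "A \<in> sigma_sets Omega {U. openin (Metric_space.mtopology Omega config_dist) U}"
      using openin_cylinder by blast
  qed
  finally show ?thesis .
qed

lemma Int_stable_cylinders: "Int_stable cylinders"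
proof -
  interpret algebra Omega cylinders by (rule algebra_cylinders)
  show ?thesis by (auto simp: Int_stable_def)
qed

lemma cylinders_Pow: "cylinders \<subseteq> Pow Omega"
  by (auto simp: cylinders_def)

lemma cylinder_in_Borel: "A \<in> cylinders \<Longrightarrow> A \<in> sets Borel_Omega"
  by (auto simp: sets_Borel_Omega)

lemma tail_gen_Pow: "{{x \<in> Omega. x j \<in> B} | j B. n + 1 \<le> j \<and> B \<subseteq> spins} \<subseteq> Pow Omega"
  by auto

lemma space_tail_algebra: "space (tail_algebra n) = Omega"
  unfolding tail_algebra_def by (rule space_measure_of[OF tail_gen_Pow])

lemma tail_algebra_coordinate:
  assumes "n + 1 \<le> j" "B \<subseteq> spins"
  shows "{x \<in> Omega. x j \<in> B} \<in> sets (tail_algebra n)"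
  unfolding tail_algebra_def sets_measure_of[OF tail_gen_Pow]
  using assms by (intro sigma_sets.Basic) auto

text \<open>The measurability of \<^const>\<open>glue\<close> is checked on single coordinates. This is possible since a
  cylinder event is a finite union, over the words of length \<open>n\<close> occurring in it, of finite
  intersections of coordinate events.\<close>

lemma sets_tail_algebra_0: "sets Borel_Omega = sets (tail_algebra 0)"
proof
  have "A \<in> sets (tail_algebra 0)" if "A \<in> cylinders" for A
  proof -
    obtain n where n: "A \<subseteq> Omega" "\<And>x y. x \<in> A \<Longrightarrow> y \<in> Omega \<Longrightarrow> agree n x y \<Longrightarrow> y \<in> A"
      using \<open>A \<in> cylinders\<close> unfolding cylinders_def by blast
    define R where "R = {a \<in> fibre n plus_config. a \<in> A}"
    define Q where "Q a = Omega \<inter> (\<Inter>i\<in>{1..n}. {x \<in> Omega. x i \<in> {a i}})" for a :: "nat \<Rightarrow> real"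
    have "finite R" by (simp add: R_def finite_fibre)
    have "A = (\<Union>a\<in>R. Q a)"
    proof (intro equalityI subsetI)
      fix x assume x: "x \<in> A"
      then have "x \<in> Omega" using n(1) by auto
      then have spl: "glue n x plus_config \<in> Omega"
        by (simp add: glue_in_Omega plus_config_in_Omega)
      then have "glue n x plus_config \<in> R"
        using n(2)[OF x spl agree_glue]
        by (auto simp: R_def fibre_iff[OF plus_config_in_Omega] glue_def)
      moreover have "x \<in> Q (glue n x plus_config)"
        using \<open>x \<in> Omega\<close> by (auto simp: Q_def glue_def)
      ultimately show "x \<in> (\<Union>a\<in>R. Q a)" by blast
    next
      fix x assume "x \<in> (\<Union>a\<in>R. Q a)"
      then obtain a where "a \<in> A" "x \<in> Omega" "agree n a x"
        by (auto simp: R_def Q_def agree_def)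
      then show "x \<in> A" using n(2) by blast
    qed
    moreover have "Q a \<in> sets (tail_algebra 0)" if "a \<in> R" for a
    proof -
      have "a \<in> Omega" using that n(1) by (auto simp: R_def)
      then have "{x \<in> Omega. x i \<in> {a i}} \<in> sets (tail_algebra 0)" if "i \<in> {1..n}" for i
        using that Omega_spin by (intro tail_algebra_coordinate) auto
      moreover have "Omega \<in> sets (tail_algebra 0)"
        using sets.top[of "tail_algebra 0"] by (simp only: space_tail_algebra)
      ultimately show ?thesis
        unfolding Q_def by (cases "{1..n} = {}") (simp, intro sets.Int sets.finite_INT, auto)
    qed
    ultimately show ?thesis using \<open>finite R\<close> by auto
  qed
  then show "sets Borel_Omega \<subseteq> sets (tail_algebra 0)"
    unfolding sets_Borel_Omega using sets.sigma_sets_subset[of cylinders "tail_algebra 0"]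
    by (auto simp: space_tail_algebra)
  have "{{x \<in> Omega. x j \<in> B} | j B. 0 + 1 \<le> j \<and> B \<subseteq> spins} \<subseteq> sets Borel_Omega"
  proof clarify
    fix j :: nat and B assume "0 + 1 \<le> j"
    then have "{x \<in> Omega. x j \<in> B} \<in> cylinders"
      by (intro agree_in_cylinders[of j]) (auto simp: agree_def)
    then show "{x \<in> Omega. x j \<in> B} \<in> sets Borel_Omega" by (rule cylinder_in_Borel)
  qed
  then show "sets (tail_algebra 0) \<subseteq> sets Borel_Omega"
    unfolding tail_algebra_def sets_measure_of[OF tail_gen_Pow]
    using sets.sigma_sets_subset[of _ Borel_Omega] unfolding space_Borel_Omega by blast
qed

lemma glue_measurable:
  assumes "a \<in> Omega"
  shows "glue n a \<in> tail_algebra n \<rightarrow>\<^sub>M Borel_Omega"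
proof -
  have "glue n a \<in> tail_algebra n \<rightarrow>\<^sub>M tail_algebra 0"
    unfolding tail_algebra_def[of 0]
  proof (rule measurable_sigma_sets[OF sets_measure_of[OF tail_gen_Pow] tail_gen_Pow])
    show "glue n a \<in> space (tail_algebra n) \<rightarrow> Omega"
      using assms by (auto simp: space_tail_algebra glue_in_Omega)
    fix Y assume "Y \<in> {{x \<in> Omega. x j \<in> B} | j B. 0 + 1 \<le> j \<and> B \<subseteq> spins}"
    then obtain j B where Y: "Y = {x \<in> Omega. x j \<in> B}" "1 \<le> j" "B \<subseteq> spins" by auto
    have "glue n a -` Y \<inter> Omega =
        (if j \<le> n then (if a j \<in> B then Omega else {}) else {x \<in> Omega. x j \<in> B})"
      using assms by (auto simp: Y(1) glue_in_Omega) (auto simp: glue_def)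
    moreover have "Omega \<in> sets (tail_algebra n)"
      using sets.top[of "tail_algebra n"] by (simp only: space_tail_algebra)
    ultimately show "glue n a -` Y \<inter> space (tail_algebra n) \<in> sets (tail_algebra n)"
      using tail_algebra_coordinate[of n j B] Y by (auto simp: space_tail_algebra)
  qed
  then show ?thesis
    using measurable_cong_sets[OF refl sets_tail_algebra_0[symmetric]] by blast
qed

text \<open>This is what makes the kernels proper: they act as the identity on tail events.\<close>

lemma tail_algebra_fibre:
  assumes "A \<in> sets (tail_algebra n)" "y \<in> Omega" "x \<in> fibre n y"
  shows "x \<in> A \<longleftrightarrow> y \<in> A"
proof -
  have "A \<in> sigma_sets Omega {{x \<in> Omega. x j \<in> B} | j B. n + 1 \<le> j \<and> B \<subseteq> spins}"
    using assms(1) unfolding tail_algebra_def sets_measure_of[OF tail_gen_Pow] .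
  then show ?thesis
    using assms(2,3) by induction (auto simp: fibre_iff)
qed

text \<open>Compactness of the configuration space: cylinder events are closed in the product topology. It
  turns every finitely additive function on cylinder events into a premeasure.\<close>

lemma decseq_cylinders_empty:
  assumes "range A \<subseteq> cylinders" "decseq A" "(\<Inter>i. A i) = {}"
  shows "\<exists>i. A i = {}"
proof (rule ccontr)
  assume "\<nexists>i. A i = {}"
  define X where "X = product_topology (\<lambda>_. discrete_topology spins) {1::nat..}"
  have topX: "topspace X = Omega" by (simp add: X_def Omega_def)
  have "compact_space X"
    unfolding X_def by (simp add: compact_space_product_topology compact_space_discrete_topology spins_def)
  have op: "openin X B" if "B \<in> cylinders" for B
  proof -
    obtain n where n: "B \<subseteq> Omega" "\<And>x y. x \<in> B \<Longrightarrow> y \<in> Omega \<Longrightarrow> agree n x y \<Longrightarrow> y \<in> B"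
      using \<open>B \<in> cylinders\<close> unfolding cylinders_def by blast
    have "\<exists>U. finite {i \<in> {1..}. U i \<noteq> topspace (discrete_topology spins)} \<and>
        (\<forall>i\<in>{1..}. openin (discrete_topology spins) (U i)) \<and> x \<in> Pi\<^sub>E {1..} U \<and> Pi\<^sub>E {1..} U \<subseteq> B"
      if x: "x \<in> B" for x
    proof (intro exI conjI)
      define U where "U i = (if i \<le> n then {x i} else spins)" for i
      have xO: "x \<in> Omega" using x n(1) by auto
      show "finite {i \<in> {1..}. U i \<noteq> topspace (discrete_topology spins)}"
        by (rule finite_subset[of _ "{..n}"]) (auto simp: U_def)
      show "\<forall>i\<in>{1..}. openin (discrete_topology spins) (U i)"
        using Omega_spin[OF xO] by (auto simp: U_def)
      show "x \<in> Pi\<^sub>E {1..} U"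
        using xO by (auto simp: Omega_def U_def PiE_iff)
      show "Pi\<^sub>E {1..} U \<subseteq> B"
      proof
        fix y assume y: "y \<in> Pi\<^sub>E {1..} U"
        then have "y i \<in> U i" if "1 \<le> i" for i using that by auto
        then have *: "y i = x i" if "1 \<le> i" "i \<le> n" for i
          using that by (force simp: U_def)
        have "y i \<in> spins" if "1 \<le> i" for i
          using \<open>\<And>i. 1 \<le> i \<Longrightarrow> y i \<in> U i\<close>[OF that] Omega_spin[OF xO that]
          by (auto simp: U_def split: if_splits)
        then have "y \<in> Omega" using y by (auto simp: Omega_def PiE_iff)
        then show "y \<in> B" using n(2)[OF x] * by (auto simp: agree_def)
      qed
    qed
    then show ?thesis unfolding X_def openin_product_topology_alt by blast
  qed
  interpret algebra Omega cylinders by (rule algebra_cylinders)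
  have "closedin X (A i)" for i
  proof -
    have "A i \<in> cylinders" using assms(1) by auto
    then have "A i \<subseteq> Omega" "Omega - A i \<in> cylinders"
      using cylinders_Pow by auto
    then show ?thesis using op[of "Omega - A i"] by (simp add: closedin_def topX)
  qed
  then have "(\<Inter>i. A i) \<noteq> {}"
    using \<open>compact_space X\<close> \<open>\<nexists>i. A i = {}\<close> assms(2) by (intro compact_space_imp_nest) auto
  with assms(3) show False by simp
qed

section \<open>Averages over fibres\<close>

text \<open>A Doeblin estimate. The part \<open>r * p\<close> of the two probability vectors is common to both and
  cancels, so only the mass \<open>1 - r\<close> can see the oscillation \<open>\<theta>\<close> of the values. The same
  estimate serves twice below: with \<open>r\<close> bounded away from \<open>0\<close> it is a contraction, and with \<open>r\<close> close
  to \<open>1\<close> it is a modulus of continuity.\<close>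

lemma weighted_mean_diff:
  fixes p q s t :: "'a \<Rightarrow> real"
  assumes I: "finite I" "I \<noteq> {}"
    and p: "\<And>i. i \<in> I \<Longrightarrow> 0 \<le> p i" "sum p I = 1"
    and q: "\<And>i. i \<in> I \<Longrightarrow> 0 \<le> q i" "sum q I = 1"
    and le: "\<And>i. i \<in> I \<Longrightarrow> r * p i \<le> q i" and r: "r \<le> 1"
    and st: "\<And>i. i \<in> I \<Longrightarrow> \<bar>s i - t i\<bar> \<le> \<eta>"
    and osc: "\<And>i j. i \<in> I \<Longrightarrow> j \<in> I \<Longrightarrow> s i - s j \<le> \<theta>"
  shows "(\<Sum>i\<in>I. s i * p i) - (\<Sum>i\<in>I. t i * q i) \<le> (1 - r) * \<theta> + \<eta>"
proof -
  \<comment> \<open>Subtracting the least value makes all values nonnegative, so that \<open>p i - q i\<close> may be replaced by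
    its upper bound \<open>(1 - r) * p i\<close>; constants do not matter as both total masses are \<open>1\<close>.\<close>
  define c where "c = Min (s ` I)"
  have c: "c \<le> s i" if "i \<in> I" for i using I that by (simp add: c_def)
  have "c \<in> s ` I" unfolding c_def using I by (intro Min_in) auto
  then have c': "s i - c \<le> \<theta>" if "i \<in> I" for i using osc that by auto
  have "(\<Sum>i\<in>I. s i * q i) - (\<Sum>i\<in>I. t i * q i) = (\<Sum>i\<in>I. (s i - t i) * q i)"
    by (simp add: sum_subtractf left_diff_distrib)
  also have "\<dots> \<le> (\<Sum>i\<in>I. \<eta> * q i)"
    using st q by (intro sum_mono mult_right_mono) (auto dest: abs_le_D1)
  also have "\<dots> = \<eta>" using q(2) by (simp flip: sum_distrib_left)
  finally have 1: "(\<Sum>i\<in>I. s i * q i) - (\<Sum>i\<in>I. t i * q i) \<le> \<eta>" .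
  have "(\<Sum>i\<in>I. s i * p i) - (\<Sum>i\<in>I. s i * q i) = (\<Sum>i\<in>I. (s i - c) * (p i - q i))"
    using p(2) q(2)
    by (simp add: sum_subtractf left_diff_distrib right_diff_distrib flip: sum_distrib_left)
  also have "\<dots> \<le> (\<Sum>i\<in>I. \<theta> * ((1 - r) * p i))"
  proof (rule sum_mono)
    fix i assume i: "i \<in> I"
    have "(s i - c) * (p i - q i) \<le> (s i - c) * ((1 - r) * p i)"
      using c[OF i] le[OF i] by (intro mult_left_mono) (auto simp: algebra_simps)
    also have "\<dots> \<le> \<theta> * ((1 - r) * p i)"
      using c'[OF i] p(1)[OF i] r by (intro mult_right_mono) auto
    finally show "(s i - c) * (p i - q i) \<le> \<theta> * ((1 - r) * p i)" .
  qed
  also have "\<dots> = (1 - r) * \<theta>" using p(2) by (simp flip: sum_distrib_left)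
  finally show ?thesis using 1 by linarith
qed

definition osc_le :: "((nat \<Rightarrow> real) \<Rightarrow> real) \<Rightarrow> real \<Rightarrow> bool" where
  "osc_le g \<theta> \<longleftrightarrow> (\<forall>x\<in>Omega. \<forall>y\<in>Omega. g x - g y \<le> \<theta>)"

text \<open>By compactness these are the continuous functions on the configuration space.\<close>

definition unif_cont :: "((nat \<Rightarrow> real) \<Rightarrow> real) \<Rightarrow> bool" where
  "unif_cont g \<longleftrightarrow>
     (\<forall>\<eta>>0. \<exists>N. \<forall>x\<in>Omega. \<forall>y\<in>Omega. agree N x y \<longrightarrow> \<bar>g x - g y\<bar> \<le> \<eta>)"

lemma osc_leD: "osc_le g \<theta> \<Longrightarrow> x \<in> Omega \<Longrightarrow> y \<in> Omega \<Longrightarrow> g x - g y \<le> \<theta>"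
  by (simp add: osc_le_def)

text \<open>Up to an error of \<open>1\<close> only finitely many values occur, one for each word of some fixed length.\<close>

lemma unif_cont_bounded_osc:
  assumes "unif_cont g"
  obtains B where "0 < B" "osc_le g B"
proof -
  obtain N where N: "\<And>x y. x \<in> Omega \<Longrightarrow> y \<in> Omega \<Longrightarrow> agree N x y \<Longrightarrow> \<bar>g x - g y\<bar> \<le> 1"
    using assms zero_less_one unfolding unif_cont_def by blast
  define C where "C = (\<Sum>a\<in>fibre N plus_config. \<bar>g a\<bar>)"
  have bd: "\<bar>g x\<bar> \<le> C + 1" if x: "x \<in> Omega" for x
  proof -
    let ?a = "glue N x plus_config"
    have a: "?a \<in> Omega" using x by (simp add: glue_in_Omega plus_config_in_Omega)
    then have "?a \<in> fibre N plus_config"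
      by (simp add: fibre_iff plus_config_in_Omega) (simp add: glue_def)
    then have "\<bar>g ?a\<bar> \<le> C"
      unfolding C_def by (intro member_le_sum) (auto simp: finite_fibre)
    then show ?thesis using N[OF x a agree_glue] by linarith
  qed
  have "0 \<le> C" by (simp add: C_def sum_nonneg)
  show thesis
  proof
    show "0 < 2 * C + 2" using \<open>0 \<le> C\<close> by simp
    show "osc_le g (2 * C + 2)"
      unfolding osc_le_def
    proof (intro ballI)
      fix x y assume "x \<in> Omega" "y \<in> Omega"
      then show "g x - g y \<le> 2 * C + 2" using bd[of x] bd[of y] by linarith
    qed
  qed
qed

lemma unif_cont_measurable:
  assumes "unif_cont g"
  shows "g \<in> borel_measurable Borel_Omega"
proof (rule borel_measurableI_less)
  fix c
  have "{x \<in> Omega. g x < c} \<in> sigma_sets Omega cylinders"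
  proof (rule open_in_sigma_cylinders)
    fix x assume x: "x \<in> {x \<in> Omega. g x < c}"
    then have "0 < (c - g x) / 2" by simp
    then obtain N where N: "\<forall>x'\<in>Omega. \<forall>y\<in>Omega. agree N x' y \<longrightarrow> \<bar>g x' - g y\<bar> \<le> (c - g x) / 2"
      using assms unfolding unif_cont_def by blast
    have "g y < c" if "y \<in> Omega" "agree N x y" for y
    proof -
      have "\<bar>g x - g y\<bar> \<le> (c - g x) / 2" using N x that by blast
      moreover have "g x < c" using x by simp
      ultimately show ?thesis by argo
    qed
    then show "\<exists>N. \<forall>y\<in>Omega. agree N x y \<longrightarrow> y \<in> {x \<in> Omega. g x < c}" by blast
  qed auto
  then show "{x \<in> space Borel_Omega. g x < c} \<in> sets Borel_Omega"
    by (simp add: sets_Borel_Omega space_Borel_Omega)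
qed

lemma unif_cont_cylinder:
  assumes "A \<in> cylinders"
  shows "unif_cont (indicator A)"
proof -
  obtain n where "\<And>x y. x \<in> A \<Longrightarrow> y \<in> Omega \<Longrightarrow> agree n x y \<Longrightarrow> y \<in> A"
    using assms unfolding cylinders_def by blast
  then have "x \<in> A \<longleftrightarrow> y \<in> A" if "x \<in> Omega" "y \<in> Omega" "agree n x y" for x y
    using that agree_sym by blast
  then have "\<bar>indicator A x - indicator A y :: real\<bar> = 0"
    if "x \<in> Omega" "y \<in> Omega" "agree n x y" for x y
    using that by (simp add: indicator_def)
  then show ?thesis unfolding unif_cont_def by (intro allI impI exI[of _ n]) simp
qed

text \<open>The kernel acting on functions. For indicator functions it is \<^const>\<open>kernel\<close>.\<close>

definition gibbs_avg ::
    "((nat \<Rightarrow> real) \<Rightarrow> real) \<Rightarrow> nat \<Rightarrow> ((nat \<Rightarrow> real) \<Rightarrow> real) \<Rightarrow> (nat \<Rightarrow> real) \<Rightarrow> real" where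
  "gibbs_avg f n g y =
     (\<Sum>x\<in>fibre n y. g x * (exp (birkhoff_sum n f x) / partition_function f n y))"

lemma kernel_eq_gibbs_avg: "kernel f n F = gibbs_avg f n (indicator F)"
  by (rule ext) (simp add: kernel_def gibbs_avg_def sum_distrib_left)

lemma partition_function_pos: "y \<in> Omega \<Longrightarrow> 0 < partition_function f n y"
  unfolding partition_function_def
  using self_in_fibre by (intro sum_pos) (auto simp: finite_fibre)

lemma gibbs_weights_sum:
  "y \<in> Omega \<Longrightarrow> (\<Sum>x\<in>fibre n y. exp (birkhoff_sum n f x) / partition_function f n y) = 1"
  using partition_function_pos[of y f n]
  by (simp add: partition_function_def flip: sum_divide_distrib)

lemma gibbs_avg_const: "y \<in> Omega \<Longrightarrow> gibbs_avg f n (\<lambda>_. c) y = c"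
  unfolding gibbs_avg_def by (simp only: gibbs_weights_sum mult_1_right flip: sum_distrib_left)

lemma gibbs_avg_mono:
  assumes "y \<in> Omega" "\<And>x. x \<in> fibre n y \<Longrightarrow> g x \<le> h x"
  shows "gibbs_avg f n g y \<le> gibbs_avg f n h y"
  unfolding gibbs_avg_def using assms partition_function_pos[of y f n]
  by (intro sum_mono mult_right_mono) auto

lemma gibbs_avg_cong:
  assumes "\<And>x. x \<in> fibre n y \<Longrightarrow> g x = h x"
  shows "gibbs_avg f n g y = gibbs_avg f n h y"
  unfolding gibbs_avg_def using assms by simp

lemma gibbs_avg_diff: "gibbs_avg f n (\<lambda>x. g x - h x) y = gibbs_avg f n g y - gibbs_avg f n h y"
  unfolding gibbs_avg_def left_diff_distrib sum_subtractf ..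

lemma gibbs_avg_sum:
  "gibbs_avg f n (\<lambda>x. \<Sum>i\<in>I. c i * g i x) y = (\<Sum>i\<in>I. c i * gibbs_avg f n (g i) y)"
  unfolding gibbs_avg_def sum_distrib_right sum_distrib_left
  by (subst sum.swap) (simp add: mult.assoc)

lemma gibbs_avg_bounds:
  assumes "y \<in> Omega" "\<And>x. x \<in> Omega \<Longrightarrow> g x \<le> b"
  shows "gibbs_avg f n g y \<le> b"
  using gibbs_avg_mono[OF assms(1), of n g "\<lambda>_. b" f] gibbs_avg_const[OF assms(1), of f n b]
    assms(2) fibre_subset by fastforce

lemma gibbs_avg_lower:
  assumes "y \<in> Omega" "\<And>x. x \<in> Omega \<Longrightarrow> b \<le> g x"
  shows "b \<le> gibbs_avg f n g y"
  using gibbs_avg_mono[OF assms(1), of n "\<lambda>_. b" g f] gibbs_avg_const[OF assms(1), of f n b]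
    assms(2) fibre_subset by fastforce

lemma birkhoff_sum_split:
  "birkhoff_sum (m + k) f x = birkhoff_sum m f x + birkhoff_sum k f ((left_shift ^^ m) x)"
proof -
  have "birkhoff_sum (m + k) f x
      = (\<Sum>i<m. f ((left_shift ^^ i) x)) + (\<Sum>i<k. f ((left_shift ^^ (m + i)) x))"
    unfolding birkhoff_sum_def by (induction k) (simp_all add: add.assoc)
  also have "(\<Sum>i<k. f ((left_shift ^^ (m + i)) x)) = birkhoff_sum k f ((left_shift ^^ m) x)"
    by (simp add: birkhoff_sum_def add.commute[of m] funpow_add)
  finally show ?thesis by (simp add: birkhoff_sum_def)
qed

text \<open>The kernels form a specification. Exchanging the two sums reduces this to the factorisation
  \<open>S_n = S_m + S_(n-m) o shift^m\<close>, whose second summand is constant on the fibres of \<open>shift^m\<close>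
  and therefore cancels against the inner normalisation.\<close>

lemma gibbs_avg_consistent:
  assumes y: "y \<in> Omega" and mn: "m \<le> n"
  shows "gibbs_avg f n (gibbs_avg f m g) y = gibbs_avg f n g y"
proof -
  let ?S = "\<lambda>n x. exp (birkhoff_sum n f x)"
  let ?Z = "partition_function f m"
  let ?I = "fibre n y"
  have sub: "fibre m x = {x' \<in> ?I. (left_shift ^^ m) x' = (left_shift ^^ m) x}" if "x \<in> ?I" for x
    using fibre_mono[OF y mn that] by (auto simp: fibre_def)
  have "(\<Sum>x\<in>?I. gibbs_avg f m g x * ?S n x)
      = (\<Sum>x\<in>?I. \<Sum>x' | x' \<in> ?I \<and> (left_shift ^^ m) x' = (left_shift ^^ m) x.
           g x' * (?S m x' / ?Z x) * ?S n x)"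
    unfolding gibbs_avg_def sum_distrib_right using sub by (intro sum.cong) auto
  also have "\<dots> = (\<Sum>x'\<in>?I. \<Sum>x | x \<in> ?I \<and> (left_shift ^^ m) x' = (left_shift ^^ m) x.
           g x' * (?S m x' / ?Z x) * ?S n x)"
    by (rule sum.swap_restrict) (simp_all add: finite_fibre)
  also have "\<dots> = (\<Sum>x'\<in>?I. \<Sum>x\<in>fibre m x'. g x' * (?S m x' / ?Z x) * ?S n x)"
    using sub by (intro sum.cong) auto
  also have "\<dots> = (\<Sum>x'\<in>?I. g x' * ?S n x')"
  proof (rule sum.cong[OF refl])
    fix x' assume x': "x' \<in> ?I"
    then have x'O: "x' \<in> Omega" using fibre_subset by auto
    have "?S m x' * ?S n x = ?S n x' * ?S m x" if "x \<in> fibre m x'" for x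
    proof -
      have "(left_shift ^^ m) x = (left_shift ^^ m) x'" using that by (simp add: fibre_def)
      then show ?thesis
        using birkhoff_sum_split[of m "n - m" f x] birkhoff_sum_split[of m "n - m" f x'] mn
        by (simp flip: exp_add)
    qed
    moreover have "?Z x = ?Z x'" if "x \<in> fibre m x'" for x
      using fibre_cong[OF that] by (simp add: partition_function_def)
    ultimately have "(\<Sum>x\<in>fibre m x'. g x' * (?S m x' / ?Z x) * ?S n x)
        = (\<Sum>x\<in>fibre m x'. g x' * ?S n x' * (?S m x / ?Z x'))"
      by (intro sum.cong refl) (simp add: mult.assoc)
    also have "\<dots> = g x' * ?S n x'"
      using gibbs_weights_sum[OF x'O, of m f] by (simp only: mult_1_right flip: sum_distrib_left)
    finally show "(\<Sum>x\<in>fibre m x'. g x' * (?S m x' / ?Z x) * ?S n x) = g x' * ?S n x'" .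
  qed
  finally show ?thesis
    by (simp add: gibbs_avg_def[of f n] flip: sum_divide_distrib)
qed

section \<open>Loss of memory\<close>

text \<open>The quantitative form of the Walters condition: changing a configuration beyond coordinate \<open>n + p\<close>
  changes its \<open>n\<close>-th Birkhoff sum by at most \<open>d p\<close>, whatever \<open>n\<close>. Existence and uniqueness of
  the Gibbs measure are proved from this alone. The value \<open>d 0\<close> bounds the influence of an arbitrary
  tail and yields the contraction; the convergence of \<open>d\<close> to \<open>0\<close> keeps averages continuous.\<close>

locale bounded_distortion =
  fixes f :: "(nat \<Rightarrow> real) \<Rightarrow> real" and d :: "nat \<Rightarrow> real"
  assumes distortion: "x \<in> Omega \<Longrightarrow> y \<in> Omega \<Longrightarrow> agree (n + p) x y \<Longrightarrow>
      \<bar>birkhoff_sum n f x - birkhoff_sum n f y\<bar> \<le> d p"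
    and distortion_lim: "d \<longlonglongrightarrow> 0"
begin

abbreviation avg :: "nat \<Rightarrow> ((nat \<Rightarrow> real) \<Rightarrow> real) \<Rightarrow> (nat \<Rightarrow> real) \<Rightarrow> real" where
  "avg \<equiv> gibbs_avg f"

lemma distortion_nonneg: "0 \<le> d p"
  using distortion[OF plus_config_in_Omega plus_config_in_Omega, of 0 p]
  by (simp add: agree_def)

lemma unif_cont_birkhoff_sum: "unif_cont (birkhoff_sum n f)"
  unfolding unif_cont_def
proof (intro allI impI)
  fix \<eta> :: real assume "0 < \<eta>"
  then have "eventually (\<lambda>p. d p < \<eta>) sequentially"
    using distortion_lim order_tendstoD(2) by blast
  then obtain p where "d p < \<eta>" unfolding eventually_sequentially by blast
  then show "\<exists>N. \<forall>x\<in>Omega. \<forall>y\<in>Omega. agree N x y \<longrightarrow>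
      \<bar>birkhoff_sum n f x - birkhoff_sum n f y\<bar> \<le> \<eta>"
    using distortion[of _ _ n p] by (intro exI[of _ "n + p"]) force
qed

text \<open>Gluing the tail of \<open>v\<close> to a configuration changes its Boltzmann factor and the partition
  function by factors between \<open>exp (- d p)\<close> and \<open>exp (d p)\<close> each. Hence the weights seen from
  \<open>v\<close> dominate \<open>exp (- 2 * d p)\<close> times those seen from \<open>u\<close>. For \<open>p = 0\<close> there is no
  condition on \<open>u\<close> and \<open>v\<close>.\<close>

lemma gibbs_avg_difference:
  assumes u: "u \<in> Omega" and v: "v \<in> Omega"
    and uv: "\<And>i. n < i \<Longrightarrow> i \<le> n + p \<Longrightarrow> u i = v i"
    and g: "\<And>x. x \<in> fibre n u \<Longrightarrow> \<bar>g x - g (glue n x v)\<bar> \<le> \<eta>"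
    and osc: "osc_le g \<theta>"
  shows "avg n g u - avg n g v \<le> (1 - exp (- 2 * d p)) * \<theta> + \<eta>"
proof -
  let ?S = "birkhoff_sum n f" and ?Z = "partition_function f n"
  define P where "P x = exp (?S x) / ?Z u" for x
  define Q where "Q x = exp (?S (glue n x v)) / ?Z v" for x
  have Z: "0 < ?Z u" "0 < ?Z v" using u v by (simp_all add: partition_function_pos)
  have S: "\<bar>?S x - ?S (glue n x v)\<bar> \<le> d p" if x: "x \<in> fibre n u" for x
  proof (rule distortion)
    show "x \<in> Omega" using x fibre_subset by auto
    then show "glue n x v \<in> Omega" using v by (rule glue_in_Omega)
    show "agree (n + p) x (glue n x v)"
      using x uv by (auto simp: agree_def glue_def fibre_iff[OF u])
  qed
  have "?Z v = (\<Sum>x\<in>fibre n u. exp (?S (glue n x v)))"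
    unfolding partition_function_def by (rule sum_fibre_glue[OF u v])
  also have "\<dots> \<le> (\<Sum>x\<in>fibre n u. exp (d p) * exp (?S x))"
  proof (rule sum_mono)
    fix x assume "x \<in> fibre n u"
    from S[OF this] show "exp (?S (glue n x v)) \<le> exp (d p) * exp (?S x)"
      by (simp flip: exp_add)
  qed
  finally have Zle: "?Z v \<le> exp (d p) * ?Z u"
    by (simp add: partition_function_def sum_distrib_left)
  have "(\<Sum>x\<in>fibre n u. g x * P x) - (\<Sum>x\<in>fibre n u. g (glue n x v) * Q x)
      \<le> (1 - exp (- 2 * d p)) * \<theta> + \<eta>"
  proof (rule weighted_mean_diff)
    show "finite (fibre n u)" "fibre n u \<noteq> {}"
      using finite_fibre self_in_fibre[OF u] by auto
    show "0 \<le> P x" "0 \<le> Q x" for x using Z by (simp_all add: P_def Q_def)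
    show "sum P (fibre n u) = 1" unfolding P_def by (rule gibbs_weights_sum[OF u])
    show "sum Q (fibre n u) = 1"
      unfolding Q_def using gibbs_weights_sum[OF v, of n f]
        sum_fibre_glue[OF u v, of "\<lambda>x. exp (?S x) / ?Z v" n] by simp
    show "exp (- 2 * d p) \<le> 1" using distortion_nonneg by simp
    show "\<bar>g x - g (glue n x v)\<bar> \<le> \<eta>" if "x \<in> fibre n u" for x using g[OF that] .
    show "g x - g y \<le> \<theta>" if "x \<in> fibre n u" "y \<in> fibre n u" for x y
      using that osc_leD[OF osc] fibre_subset by blast
    fix x assume "x \<in> fibre n u"
    from S[OF this] have "exp (- d p) * exp (?S x) \<le> exp (?S (glue n x v))"
      by (simp flip: exp_add)
    then have "exp (- d p) * exp (?S x) * ?Z v \<le> exp (?S (glue n x v)) * (exp (d p) * ?Z u)"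
      using Zle Z by (intro mult_mono) auto
    then have "exp (- d p) * (exp (- d p) * exp (?S x) * ?Z v)
        \<le> exp (- d p) * (exp (?S (glue n x v)) * (exp (d p) * ?Z u))"
      by (intro mult_left_mono) auto
    also have "\<dots> = exp (?S (glue n x v)) * ?Z u"
      by (simp add: exp_minus)
    also have "exp (- d p) * (exp (- d p) * exp (?S x) * ?Z v) = exp (- 2 * d p) * exp (?S x) * ?Z v"
      by (simp flip: exp_add mult.assoc)
    finally show "exp (- 2 * d p) * P x \<le> Q x"
      unfolding P_def Q_def using Z by (simp add: field_simps)
  qed
  moreover have "avg n g v = (\<Sum>x\<in>fibre n u. g (glue n x v) * Q x)"
    unfolding gibbs_avg_def Q_def by (rule sum_fibre_glue[OF u v])
  ultimately show ?thesis by (simp add: gibbs_avg_def P_def)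
qed

lemma unif_cont_gibbs_avg:
  assumes "unif_cont g"
  shows "unif_cont (avg n g)"
  unfolding unif_cont_def
proof (intro allI impI)
  fix \<eta> :: real assume "0 < \<eta>"
  then have \<eta>: "0 < \<eta> / 2" by simp
  obtain B where B: "0 < B" "osc_le g B" using unif_cont_bounded_osc[OF assms] .
  obtain N where N: "\<And>x y. x \<in> Omega \<Longrightarrow> y \<in> Omega \<Longrightarrow> agree N x y \<Longrightarrow> \<bar>g x - g y\<bar> \<le> \<eta> / 2"
    using assms \<eta> unfolding unif_cont_def by blast
  have "(\<lambda>p. (1 - exp (- 2 * d p)) * B) \<longlonglongrightarrow> (1 - exp (- 2 * 0)) * B"
    by (intro tendsto_intros distortion_lim)
  then have "eventually (\<lambda>p. (1 - exp (- 2 * d p)) * B < \<eta> / 2) sequentially"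
    using \<eta> order_tendstoD(2) by fastforce
  then obtain p where p: "(1 - exp (- 2 * d p)) * B < \<eta> / 2"
    unfolding eventually_sequentially by blast
  have *: "avg n g u - avg n g v \<le> \<eta>"
    if u: "u \<in> Omega" and v: "v \<in> Omega" and uv: "agree (max N (n + p)) u v" for u v
  proof -
    have "avg n g u - avg n g v \<le> (1 - exp (- 2 * d p)) * B + \<eta> / 2"
    proof (rule gibbs_avg_difference[OF u v _ _ B(2)])
      show "u i = v i" if "n < i" "i \<le> n + p" for i
        using uv that by (auto simp: agree_def)
      fix x assume x: "x \<in> fibre n u"
      then have xO: "x \<in> Omega" using fibre_subset by auto
      have "agree N x (glue n x v)"
        using uv x by (auto simp: agree_def glue_def fibre_iff[OF u])
      then show "\<bar>g x - g (glue n x v)\<bar> \<le> \<eta> / 2"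
        using N xO glue_in_Omega[OF xO v] by blast
    qed
    then show ?thesis using p by linarith
  qed
  show "\<exists>N. \<forall>x\<in>Omega. \<forall>y\<in>Omega. agree N x y \<longrightarrow> \<bar>avg n g x - avg n g y\<bar> \<le> \<eta>"
  proof (intro exI ballI impI)
    fix x y assume "x \<in> Omega" "y \<in> Omega" "agree (max N (n + p)) x y"
    then show "\<bar>avg n g x - avg n g y\<bar> \<le> \<eta>"
      using *[of x y] *[of y x] agree_sym by (auto simp: abs_le_iff)
  qed
qed

text \<open>The continuous function \<open>avg m g\<close> is nearly determined by its first \<open>N\<close> coordinates. Averaging it
  once more over \<open>max m N\<close> coordinates, which by consistency gives an average of \<open>g\<close> itself,
  therefore contracts its oscillation by \<open>1 - exp (- 2 * d 0)\<close>, up to an error that may be chosen to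
  eat up half of the gain.\<close>

lemma oscillation_step:
  assumes g: "unif_cont g" and osc: "osc_le (avg m g) \<theta>" and \<theta>: "0 < \<theta>"
  shows "\<exists>n. osc_le (avg n g) ((1 - exp (- 2 * d 0) / 2) * \<theta>)"
proof -
  define r where "r = exp (- 2 * d 0)"
  have "0 < r * \<theta> / 2" using \<theta> by (simp add: r_def)
  then obtain N where N: "\<And>x y. x \<in> Omega \<Longrightarrow> y \<in> Omega \<Longrightarrow> agree N x y \<Longrightarrow>
      \<bar>avg m g x - avg m g y\<bar> \<le> r * \<theta> / 2"
    using unif_cont_gibbs_avg[OF g, of m] unfolding unif_cont_def by blast
  let ?n = "max m N"
  have "avg ?n g u - avg ?n g v \<le> (1 - r / 2) * \<theta>" if u: "u \<in> Omega" and v: "v \<in> Omega" for u v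
  proof -
    have "avg ?n (avg m g) u - avg ?n (avg m g) v \<le> (1 - exp (- 2 * d 0)) * \<theta> + r * \<theta> / 2"
    proof (rule gibbs_avg_difference[OF u v _ _ osc])
      fix x assume "x \<in> fibre ?n u"
      then have x: "x \<in> Omega" using fibre_subset by auto
      show "\<bar>avg m g x - avg m g (glue ?n x v)\<bar> \<le> r * \<theta> / 2"
        using N[OF x glue_in_Omega[OF x v]] agree_mono[OF agree_glue] by simp
    qed (auto simp: max_def split: if_splits)
    also have "\<dots> = (1 - r / 2) * \<theta>" by (simp add: r_def field_simps)
    finally show ?thesis using u v by (simp add: gibbs_avg_consistent)
  qed
  then show ?thesis unfolding osc_le_def r_def by blast
qed

lemma oscillation_tends_to_zero:
  assumes g: "unif_cont g" and \<theta>: "0 < \<theta>"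
  shows "\<exists>m. osc_le (avg m g) \<theta>"
proof -
  define r where "r = 1 - exp (- 2 * d 0) / 2"
  have "exp (- 2 * d 0) \<le> 1" using distortion_nonneg by simp
  then have r: "0 < r" "r < 1"
    using exp_gt_zero[of "- 2 * d 0"] unfolding r_def by linarith+
  obtain B where B: "0 < B" "osc_le g B" using unif_cont_bounded_osc[OF g] .
  have "\<exists>m. osc_le (avg m g) (r ^ k * B)" for k
  proof (induction k)
    case 0
    have "avg 0 g x = g x" if "x \<in> Omega" for x
    proof -
      have "fibre 0 x = {x}" using that by (auto simp: fibre_def)
      then show ?thesis by (simp add: gibbs_avg_def partition_function_def birkhoff_sum_def)
    qed
    then have "osc_le (avg 0 g) B" using B(2) by (simp add: osc_le_def)
    then show ?case by auto
  next
    case (Suc k)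
    then obtain m where "osc_le (avg m g) (r ^ k * B)" by blast
    from oscillation_step[OF g this] show ?case
      using r B(1) by (simp add: r_def mult.assoc)
  qed
  moreover have "(\<lambda>k. r ^ k * B) \<longlonglongrightarrow> 0"
    using r by (intro tendsto_mult_left_zero LIMSEQ_realpow_zero) auto
  then have "eventually (\<lambda>k. r ^ k * B < \<theta>) sequentially"
    using \<theta> order_tendstoD(2) by blast
  then obtain k where "r ^ k * B < \<theta>" unfolding eventually_sequentially by blast
  ultimately obtain m where "osc_le (avg m g) (r ^ k * B)" by blast
  with \<open>r ^ k * B < \<theta>\<close> have "osc_le (avg m g) \<theta>" unfolding osc_le_def by force
  then show ?thesis ..
qed

text \<open>By consistency \<open>avg n g u\<close> is a mean of values of \<open>avg m g\<close>.\<close>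

lemma gibbs_avg_near:
  assumes "osc_le (avg m g) \<theta>" "m \<le> n" "u \<in> Omega" "v \<in> Omega"
  shows "\<bar>avg n g u - avg m g v\<bar> \<le> \<theta>"
proof -
  have "avg n (avg m g) u \<le> avg m g v + \<theta>"
    using osc_leD[OF assms(1) _ assms(4)] by (intro gibbs_avg_bounds[OF assms(3)]) force
  moreover have "avg m g v - \<theta> \<le> avg n (avg m g) u"
    using osc_leD[OF assms(1) assms(4)] by (intro gibbs_avg_lower[OF assms(3)]) force
  ultimately show ?thesis
    using assms(2,3) by (simp add: gibbs_avg_consistent abs_le_iff)
qed

lemma osc_le_gibbs_avg_mono:
  assumes "osc_le (avg m g) \<theta>" "m \<le> n"
  shows "osc_le (avg n g) \<theta>"
  unfolding osc_le_def
proof (intro ballI)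
  fix u v assume u: "u \<in> Omega" and v: "v \<in> Omega"
  have "avg n g u - \<theta> \<le> avg m g w" if "w \<in> Omega" for w
    using gibbs_avg_near[OF assms u that] by (simp add: abs_le_iff)
  then have "avg n g u - \<theta> \<le> avg n (avg m g) v"
    by (intro gibbs_avg_lower[OF v])
  then show "avg n g u - avg n g v \<le> \<theta>"
    using gibbs_avg_consistent[OF v assms(2), of f g] by linarith
qed

text \<open>The expectation functional of the Gibbs measure. The boundary condition \<^const>\<open>plus_config\<close> is
  arbitrary, as the limit is the same for all of them.\<close>

definition limit_avg :: "((nat \<Rightarrow> real) \<Rightarrow> real) \<Rightarrow> real" where
  "limit_avg g = lim (\<lambda>n. avg n g plus_config)"

lemma limit_avg:
  assumes g: "unif_cont g" and u: "u \<in> Omega"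
  shows "(\<lambda>n. avg n g u) \<longlonglongrightarrow> limit_avg g"
proof -
  have "Cauchy (\<lambda>n. avg n g plus_config)"
  proof (rule metric_CauchyI)
    fix e :: real assume "0 < e"
    then obtain m where m: "osc_le (avg m g) (e / 3)"
      using oscillation_tends_to_zero[OF g, of "e / 3"] by auto
    have "dist (avg n g plus_config) (avg n' g plus_config) < e" if "n \<ge> m" "n' \<ge> m" for n n'
      using gibbs_avg_near[OF m that(1) plus_config_in_Omega plus_config_in_Omega]
        gibbs_avg_near[OF m that(2) plus_config_in_Omega plus_config_in_Omega] \<open>0 < e\<close>
      unfolding dist_real_def by linarith
    then show "\<exists>M. \<forall>m\<ge>M. \<forall>n\<ge>M. dist (avg m g plus_config) (avg n g plus_config) < e" by blast
  qed
  then have 1: "(\<lambda>n. avg n g plus_config) \<longlonglongrightarrow> limit_avg g"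
    by (simp add: limit_avg_def Cauchy_convergent_iff convergent_LIMSEQ_iff)
  have "(\<lambda>n. avg n g u - avg n g plus_config) \<longlonglongrightarrow> 0"
  proof (rule LIMSEQ_I)
    fix e :: real assume "0 < e"
    then obtain m where m: "osc_le (avg m g) (e / 3)"
      using oscillation_tends_to_zero[OF g, of "e / 3"] by auto
    have "norm (avg n g u - avg n g plus_config - 0) < e" if "n \<ge> m" for n
      using gibbs_avg_near[OF m that plus_config_in_Omega plus_config_in_Omega]
        gibbs_avg_near[OF m that u plus_config_in_Omega] \<open>0 < e\<close>
      unfolding real_norm_def by linarith
    then show "\<exists>M. \<forall>n\<ge>M. norm (avg n g u - avg n g plus_config - 0) < e" by blast
  qed
  from tendsto_add[OF this 1] show ?thesis by simp
qed

lemma limit_avg_unique: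
  assumes "unif_cont g" "(\<lambda>n. avg n g plus_config) \<longlonglongrightarrow> l"
  shows "limit_avg g = l"
  using LIMSEQ_unique[OF limit_avg[OF assms(1) plus_config_in_Omega] assms(2)] .

lemma limit_avg_const: "limit_avg (\<lambda>_. c) = c"
  by (rule limit_avg_unique) (simp_all add: unif_cont_def gibbs_avg_const plus_config_in_Omega)

lemma limit_avg_nonneg:
  assumes "unif_cont g" "\<And>x. x \<in> Omega \<Longrightarrow> 0 \<le> g x"
  shows "0 \<le> limit_avg g"
  using limit_avg[OF assms(1) plus_config_in_Omega] gibbs_avg_lower[OF plus_config_in_Omega assms(2)]
  by (intro LIMSEQ_le_const) auto

lemma limit_avg_dist:
  assumes "unif_cont g" "unif_cont h" "\<And>x. x \<in> Omega \<Longrightarrow> \<bar>g x - h x\<bar> \<le> \<eta>"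
  shows "\<bar>limit_avg g - limit_avg h\<bar> \<le> \<eta>"
proof -
  have "(\<lambda>n. \<bar>avg n g plus_config - avg n h plus_config\<bar>) \<longlonglongrightarrow> \<bar>limit_avg g - limit_avg h\<bar>"
    using assms plus_config_in_Omega by (intro tendsto_intros limit_avg)
  moreover have "\<bar>avg n g plus_config - avg n h plus_config\<bar> \<le> \<eta>" for n
  proof -
    have "avg n (\<lambda>x. g x - h x) plus_config \<le> \<eta>"
      using assms(3) by (intro gibbs_avg_bounds plus_config_in_Omega) (auto simp: abs_le_iff)
    moreover have "- \<eta> \<le> avg n (\<lambda>x. g x - h x) plus_config"
      using assms(3) by (intro gibbs_avg_lower plus_config_in_Omega) (force simp: abs_le_iff)
    ultimately show ?thesis by (simp add: gibbs_avg_diff abs_le_iff)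
  qed
  ultimately show ?thesis by (intro LIMSEQ_le_const2) auto
qed

lemma limit_avg_sum:
  assumes "\<And>i. i \<in> I \<Longrightarrow> unif_cont (g i)" "unif_cont (\<lambda>x. \<Sum>i\<in>I. c i * g i x)"
  shows "limit_avg (\<lambda>x. \<Sum>i\<in>I. c i * g i x) = (\<Sum>i\<in>I. c i * limit_avg (g i))"
  by (intro limit_avg_unique assms(2))
    (auto simp: gibbs_avg_sum intro!: tendsto_intros limit_avg assms plus_config_in_Omega)

lemma limit_avg_invariant:
  assumes "unif_cont g"
  shows "limit_avg (avg m g) = limit_avg g"
proof (rule limit_avg_unique[OF unif_cont_gibbs_avg[OF assms]])
  have "eventually (\<lambda>n. avg n g plus_config = avg n (avg m g) plus_config) sequentially"
    using gibbs_avg_consistent[OF plus_config_in_Omega]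
    by (auto simp: eventually_sequentially intro!: exI[of _ m])
  then show "(\<lambda>n. avg n (avg m g) plus_config) \<longlonglongrightarrow> limit_avg g"
    using limit_avg[OF assms plus_config_in_Omega] tendsto_cong by fastforce
qed

lemma gibbs_avg_limit_dist:
  assumes "unif_cont g" "osc_le (avg m g) \<theta>" "v \<in> Omega"
  shows "\<bar>limit_avg g - avg m g v\<bar> \<le> \<theta>"
proof -
  have "(\<lambda>n. \<bar>avg n g v - avg m g v\<bar>) \<longlonglongrightarrow> \<bar>limit_avg g - avg m g v\<bar>"
    using assms by (intro tendsto_intros limit_avg)
  then show ?thesis
    using gibbs_avg_near[OF assms(2) _ assms(3) assms(3)] by (intro LIMSEQ_le_const2) auto
qed

end

section \<open>Gibbs measures\<close>

lemma gibbs_avg_measurable: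
  assumes "unif_cont (birkhoff_sum n f)" "g \<in> borel_measurable Borel_Omega"
  shows "gibbs_avg f n g \<in> borel_measurable (tail_algebra n)"
proof -
  let ?W = "fibre n plus_config"
  let ?S = "birkhoff_sum n f"
  have S: "(\<lambda>x. exp (?S x)) \<in> borel_measurable Borel_Omega"
    by (rule measurable_compose[OF unif_cont_measurable[OF assms(1)] borel_measurable_exp])
  have glue: "(\<lambda>y. h (glue n a y)) \<in> borel_measurable (tail_algebra n)"
    if "h \<in> borel_measurable Borel_Omega" "a \<in> ?W" for h :: "(nat \<Rightarrow> real) \<Rightarrow> real" and a
  proof -
    have "a \<in> Omega" using that(2) fibre_subset by auto
    from measurable_compose[OF glue_measurable[OF this] that(1)] show ?thesis .
  qed
  have meas: "(\<lambda>y. \<Sum>a\<in>?W. g (glue n a y) * (exp (?S (glue n a y)) / (\<Sum>b\<in>?W. exp (?S (glue n b y)))))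
      \<in> borel_measurable (tail_algebra n)"
    by (intro borel_measurable_sum borel_measurable_times borel_measurable_divide
        glue[OF assms(2)] glue[OF S])
  have eq: "gibbs_avg f n g y
      = (\<Sum>a\<in>?W. g (glue n a y) * (exp (?S (glue n a y)) / (\<Sum>b\<in>?W. exp (?S (glue n b y)))))"
    if "y \<in> space (tail_algebra n)" for y
  proof -
    have y: "y \<in> Omega" using that by (simp only: space_tail_algebra)
    show ?thesis
      unfolding gibbs_avg_def partition_function_def
      by (simp only: sum_fibre_glue[OF plus_config_in_Omega y])
  qed
  show ?thesis by (rule iffD2[OF measurable_cong meas]) (rule eq)
qed

lemma sets_tail_algebra_subset: "sets (tail_algebra n) \<subseteq> sets Borel_Omega"
proof -
  have "{{x \<in> Omega. x j \<in> B} | j B. n + 1 \<le> j \<and> B \<subseteq> spins}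
      \<subseteq> {{x \<in> Omega. x j \<in> B} | j B. 0 + 1 \<le> j \<and> B \<subseteq> spins}" by force
  then show ?thesis
    unfolding sets_tail_algebra_0 unfolding tail_algebra_def sets_measure_of[OF tail_gen_Pow]
    by (rule sigma_sets_mono')
qed

lemma integrable_bounded_oscillation:
  assumes M: "prob_space M" "sets M = sets Borel_Omega"
    and g: "g \<in> borel_measurable Borel_Omega" "osc_le g B"
  shows "integrable M g"
proof -
  interpret prob_space M by fact
  have "space M = Omega"
    using sets_eq_imp_space_eq[OF M(2)] by (simp only: space_Borel_Omega)
  moreover have "\<bar>g x\<bar> \<le> \<bar>g plus_config\<bar> + B" if "x \<in> Omega" for x
    using osc_leD[OF g(2) that plus_config_in_Omega] osc_leD[OF g(2) plus_config_in_Omega that]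
    by linarith
  ultimately have "AE x in M. norm (g x) \<le> \<bar>g plus_config\<bar> + B" by (intro AE_I2) simp
  moreover have "g \<in> borel_measurable M"
    using g(1) measurable_cong_sets[OF M(2) refl] by blast
  ultimately show ?thesis by (intro integrable_const_bound)
qed

lemma integral_dist:
  fixes g h :: "(nat \<Rightarrow> real) \<Rightarrow> real"
  assumes M: "prob_space M" "sets M = sets Borel_Omega"
    and "integrable M g" "integrable M h" "\<And>x. x \<in> Omega \<Longrightarrow> \<bar>g x - h x\<bar> \<le> \<eta>"
  shows "\<bar>(\<integral>x. g x \<partial>M) - (\<integral>x. h x \<partial>M)\<bar> \<le> \<eta>"
proof -
  interpret prob_space M by fact
  have space: "space M = Omega"
    using sets_eq_imp_space_eq[OF M(2)] by (simp only: space_Borel_Omega)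
  have int: "integrable M (\<lambda>x. g x - h x)" using assms(3,4) by simp
  have bd: "g x - h x \<le> \<eta> \<and> - \<eta> \<le> g x - h x" if "x \<in> space M" for x
    using assms(5)[of x] that unfolding space by linarith
  have "(\<integral>x. g x - h x \<partial>M) \<le> \<eta>" using bd by (intro integral_le_const int AE_I2) blast
  moreover have "- \<eta> \<le> (\<integral>x. g x - h x \<partial>M)" using bd by (intro integral_ge_const int AE_I2) blast
  ultimately show ?thesis using assms(3,4) by (simp add: abs_le_iff)
qed

context bounded_distortion
begin

lemma limit_avg_additive:
  assumes "A \<in> cylinders" "B \<in> cylinders" "A \<inter> B = {}"
  shows "limit_avg (indicator (A \<union> B)) = limit_avg (indicator A) + limit_avg (indicator B)"
proof (rule limit_avg_unique)
  interpret algebra Omega cylinders by (rule algebra_cylinders)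
  show "unif_cont (indicator (A \<union> B))" using assms by (intro unif_cont_cylinder) auto
  have "(\<lambda>n. avg n (indicator A) plus_config + avg n (indicator B) plus_config)
      \<longlonglongrightarrow> limit_avg (indicator A) + limit_avg (indicator B)"
    using assms by (intro tendsto_intros limit_avg unif_cont_cylinder plus_config_in_Omega)
  moreover have "avg n (indicator (A \<union> B)) plus_config
      = avg n (indicator A) plus_config + avg n (indicator B) plus_config" for n
    unfolding gibbs_avg_def indicator_add[OF assms(3), symmetric] distrib_right sum.distrib ..
  ultimately show "(\<lambda>n. avg n (indicator (A \<union> B)) plus_config)
      \<longlonglongrightarrow> limit_avg (indicator A) + limit_avg (indicator B)" by simp
qed

text \<open>Caratheodory's extension theorem applies because cylinder events are compact.\<close>

lemma limit_measure_exists: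
  "\<exists>M. prob_space M \<and> sets M = sets Borel_Omega \<and>
       (\<forall>A\<in>cylinders. measure M A = limit_avg (indicator A))"
proof -
  interpret algebra Omega cylinders by (rule algebra_cylinders)
  define F where "F A = ennreal (limit_avg (indicator A))" for A :: "(nat \<Rightarrow> real) set"
  have nonneg: "0 \<le> limit_avg (indicator A)" if "A \<in> cylinders" for A
    using that by (intro limit_avg_nonneg unif_cont_cylinder) auto
  have empty: "F {} = 0"
  proof -
    have "indicator {} = (\<lambda>_ :: nat \<Rightarrow> real. 0 :: real)" by auto
    then show ?thesis using limit_avg_const[of 0] unfolding F_def by (simp only: ennreal_0)
  qed
  have "\<exists>\<mu>. (\<forall>A\<in>cylinders. \<mu> A = F A) \<and> measure_space Omega (sigma_sets Omega cylinders) \<mu>"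
  proof (rule caratheodory_empty_continuous)
    show "positive cylinders F" using empty by (simp add: positive_def)
    show "additive cylinders F"
      unfolding additive_def F_def using nonneg by (simp add: limit_avg_additive ennreal_plus)
    show "F A \<noteq> \<infinity>" for A by (simp add: F_def)
    fix A :: "nat \<Rightarrow> (nat \<Rightarrow> real) set"
    assume A: "range A \<subseteq> cylinders" "decseq A" "(\<Inter>i. A i) = {}"
    then obtain k where k: "A k = {}" using decseq_cylinders_empty by blast
    have "F (A i) = 0" if "k \<le> i" for i
      using decseqD[OF A(2) that] k empty by simp
    then show "(\<lambda>i. F (A i)) \<longlonglongrightarrow> 0"
      by (intro tendsto_eventually) (auto simp: eventually_sequentially)
  qed
  then obtain \<mu> where \<mu>: "\<And>A. A \<in> cylinders \<Longrightarrow> \<mu> A = F A"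
    and ms: "measure_space Omega (sigma_sets Omega cylinders) \<mu>" by blast
  define M where "M = measure_of Omega (sigma_sets Omega cylinders) \<mu>"
  have sigma: "sigma_algebra Omega (sigma_sets Omega cylinders)"
    by (rule sigma_algebra_sigma_sets[OF cylinders_Pow])
  have sets: "sets M = sets Borel_Omega"
    unfolding M_def sets_Borel_Omega using sigma_algebra.sets_measure_of_eq[OF sigma] by blast
  have space: "space M = Omega"
    using sets_eq_imp_space_eq[OF sets] by (simp only: space_Borel_Omega)
  have em: "emeasure M A = F A" if "A \<in> cylinders" for A
    using that ms unfolding M_def measure_space_def
    by (subst emeasure_measure_of_sigma[OF sigma]) (auto simp: \<mu>)
  have "F Omega = 1"
  proof -
    have "\<bar>limit_avg (indicator Omega) - limit_avg (\<lambda>_. 1)\<bar> \<le> 0"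
      by (intro limit_avg_dist unif_cont_cylinder) (auto simp: unif_cont_def)
    then show ?thesis by (simp add: F_def limit_avg_const)
  qed
  then have "prob_space M" by (intro prob_spaceI) (simp add: space em)
  moreover have "measure M A = limit_avg (indicator A)" if "A \<in> cylinders" for A
    using em[OF that] nonneg[OF that] by (simp add: measure_def F_def)
  ultimately show ?thesis using sets by blast
qed

text \<open>Both sides are linear and bounded, and they agree on the indicators of cylinder events, hence on the
  functions \<open>h'\<close> of finitely many coordinates, which approximate \<open>h\<close> uniformly.\<close>

lemma integral_eq_limit_avg:
  assumes M: "prob_space M" "sets M = sets Borel_Omega"
    and cyl: "\<And>A. A \<in> cylinders \<Longrightarrow> measure M A = limit_avg (indicator A)"
    and h: "unif_cont h"
  shows "(\<integral>x. h x \<partial>M) = limit_avg h"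
proof -
  interpret prob_space M by fact
  have space: "space M = Omega"
    using sets_eq_imp_space_eq[OF M(2)] by (simp only: space_Borel_Omega)
  have "\<bar>(\<integral>x. h x \<partial>M) - limit_avg h\<bar> \<le> 0 + e" if "0 < e" for e
  proof -
    have "0 < e / 2" using that by simp
    then obtain N where N: "\<And>x y. x \<in> Omega \<Longrightarrow> y \<in> Omega \<Longrightarrow> agree N x y \<Longrightarrow> \<bar>h x - h y\<bar> \<le> e / 2"
      using h unfolding unif_cont_def by blast
    let ?W = "fibre N plus_config"
    define C where "C a = {x \<in> Omega. agree N a x}" for a
    have C: "C a \<in> cylinders" for a
      unfolding C_def by (rule agree_in_cylinders[of N]) (rule agree_trans)
    define h' where "h' x = (\<Sum>a\<in>?W. h a * indicator (C a) x)" for x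
    have h'_eq: "h' x = h (glue N x plus_config)" if x: "x \<in> Omega" for x
    proof -
      let ?a = "glue N x plus_config"
      have a: "?a \<in> ?W"
        using x by (simp add: fibre_iff plus_config_in_Omega glue_in_Omega) (simp add: glue_def)
      have "b = ?a" if "b \<in> ?W" "agree N b x" for b
      proof (rule Omega_eqI)
        show "b \<in> Omega" using that fibre_subset by auto
        show "?a \<in> Omega" using x by (simp add: glue_in_Omega plus_config_in_Omega)
        show "b i = ?a i" if "1 \<le> i" for i
          using that \<open>b \<in> ?W\<close> \<open>agree N b x\<close>
          by (auto simp: glue_def agree_def fibre_iff[OF plus_config_in_Omega])
      qed
      then have "h' x = (\<Sum>b\<in>{?a}. h b * indicator (C b) x)"
        unfolding h'_def using a x
        by (intro sum.mono_neutral_right finite_fibre) (auto simp: C_def indicator_def)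
      also have "x \<in> C ?a" using x agree_sym[OF agree_glue] by (simp add: C_def)
      then have "(\<Sum>b\<in>{?a}. h b * indicator (C b) x) = h ?a" by simp
      finally show ?thesis .
    qed
    have close: "\<bar>h x - h' x\<bar> \<le> e / 2" if "x \<in> Omega" for x
      using N[OF that _ agree_glue] that by (simp add: h'_eq glue_in_Omega plus_config_in_Omega)
    have "h' x = h' y" if "x \<in> Omega" "y \<in> Omega" "agree N x y" for x y
    proof -
      have "glue N x plus_config = glue N y plus_config"
        using that by (auto simp: glue_def agree_def fun_eq_iff Omega_zero Suc_le_eq)
           (metis One_nat_def Omega_zero Suc_leI neq0_conv)
      then show ?thesis using that by (simp add: h'_eq)
    qed
    then have h': "unif_cont h'"
      unfolding unif_cont_def by (intro allI impI exI[of _ N]) simp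
    have int: "integrable M g" if "unif_cont g" for g
      using that unif_cont_bounded_osc[OF that] unif_cont_measurable[OF that]
        integrable_bounded_oscillation[OF M] by metis
    have "(\<integral>x. h' x \<partial>M) = (\<Sum>a\<in>?W. h a * measure M (C a))"
    proof -
      have CM: "C a \<in> sets M" "C a \<subseteq> space M" for a
        using cylinder_in_Borel[OF C, of a] M(2) by (auto simp: space C_def)
      have "integrable M (\<lambda>x. h a * indicator (C a) x)" for a
        using CM(1) by (intro integrable_mult_right integrable_real_indicator)
          (auto simp: emeasure_eq_measure)
      then show ?thesis
        unfolding h'_def using CM(2) by (simp add: Int_absorb2)
    qed
    also have "\<dots> = (\<Sum>a\<in>?W. h a * limit_avg (indicator (C a)))"
      using cyl[OF C] by simp
    also have "\<dots> = limit_avg h'"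
      using h' unfolding h'_def by (intro limit_avg_sum[symmetric] unif_cont_cylinder C)
    finally have "(\<integral>x. h' x \<partial>M) = limit_avg h'" .
    moreover have "\<bar>(\<integral>x. h x \<partial>M) - (\<integral>x. h' x \<partial>M)\<bar> \<le> e / 2"
      using close by (intro integral_dist M int h h')
    moreover have "\<bar>limit_avg h - limit_avg h'\<bar> \<le> e / 2"
      using close by (intro limit_avg_dist h h')
    ultimately show ?thesis by linarith
  qed
  then have "\<bar>(\<integral>x. h x \<partial>M) - limit_avg h\<bar> \<le> 0" by (rule field_le_epsilon)
  then show ?thesis by simp
qed

lemma avg_indicator_bounds:
  assumes "y \<in> Omega"
  shows "0 \<le> avg n (indicator F) y" "avg n (indicator F) y \<le> 1"
  by (rule gibbs_avg_lower[OF assms], simp) (rule gibbs_avg_bounds[OF assms], simp)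

lemma avg_indicator_measurable:
  assumes "F \<in> sets Borel_Omega"
  shows "avg n (indicator F) \<in> borel_measurable (tail_algebra n)"
  by (rule gibbs_avg_measurable[OF unif_cont_birkhoff_sum borel_measurable_indicator[OF assms]])

lemma avg_indicator_integrable:
  assumes M: "prob_space M" "sets M = sets Borel_Omega" and F: "F \<in> sets Borel_Omega"
  shows "integrable M (avg n (indicator F))"
proof (rule integrable_bounded_oscillation[OF M])
  have "subalgebra Borel_Omega (tail_algebra n)"
    by (simp add: subalgebra_def sets_tail_algebra_subset space_Borel_Omega space_tail_algebra)
  from measurable_from_subalg[OF this avg_indicator_measurable[OF F]]
  show "avg n (indicator F) \<in> borel_measurable Borel_Omega" .
  show "osc_le (avg n (indicator F)) 1"
    unfolding osc_le_def
  proof (intro ballI)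
    fix x y assume "x \<in> Omega" "y \<in> Omega"
    then show "avg n (indicator F) x - avg n (indicator F) y \<le> 1"
      using avg_indicator_bounds[of x n F] avg_indicator_bounds[of y n F] by linarith
  qed
qed

text \<open>Invariance under the kernel extends from cylinder events to Borel events by Dynkin's theorem, as
  the kernel is countably additive in the event.\<close>

lemma integral_avg_indicator:
  assumes M: "prob_space M" "sets M = sets Borel_Omega"
    and cyl: "\<And>A. A \<in> cylinders \<Longrightarrow> (\<integral>y. avg n (indicator A) y \<partial>M) = measure M A"
    and F: "F \<in> sets Borel_Omega"
  shows "(\<integral>y. avg n (indicator F) y \<partial>M) = measure M F"
proof -
  interpret prob_space M by fact
  have space: "space M = Omega"
    using sets_eq_imp_space_eq[OF M(2)] by (simp only: space_Borel_Omega)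
  have int: "integrable M (avg n (indicator A))" if "A \<in> sigma_sets Omega cylinders" for A
    using that by (intro avg_indicator_integrable M) (simp add: sets_Borel_Omega)
  have inM: "A \<in> sets M" if "A \<in> sigma_sets Omega cylinders" for A
    using that by (simp add: M(2) sets_Borel_Omega)
  have "F \<in> sigma_sets Omega cylinders" using F by (simp add: sets_Borel_Omega)
  then show ?thesis
  proof (induction rule: sigma_sets_induct_disjoint[OF Int_stable_cylinders cylinders_Pow,
      consumes 1, case_names basic empty compl union])
    case (basic A)
    then show ?case by (rule cyl)
  next
    case empty
    then show ?case by (simp add: gibbs_avg_def)
  next
    case (compl A)
    have "avg n (indicator (Omega - A)) y = 1 - avg n (indicator A) y" if "y \<in> space M" for y
    proof -
      have y: "y \<in> Omega" using that by (simp add: space)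
      have "avg n (indicator (Omega - A)) y = avg n (\<lambda>x. 1 - indicator A x) y"
        using fibre_subset by (intro gibbs_avg_cong) (auto simp: indicator_def)
      then show ?thesis using y by (simp add: gibbs_avg_diff gibbs_avg_const)
    qed
    then have "(\<integral>y. avg n (indicator (Omega - A)) y \<partial>M) = (\<integral>y. 1 - avg n (indicator A) y \<partial>M)"
      by (rule Bochner_Integration.integral_cong[OF refl])
    also have "\<dots> = 1 - measure M A"
      using int[OF compl.hyps] compl.IH by (simp add: prob_space)
    also have "\<dots> = measure M (Omega - A)"
      using prob_compl[OF inM[OF compl.hyps]] by (simp add: space)
    finally show ?case .
  next
    case (union A)
    have U: "(\<Union>i. A i) \<in> sigma_sets Omega cylinders"
      using union.hyps(2) by (intro sigma_sets.Union) auto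
    have em: "(\<integral>\<^sup>+y. ennreal (avg n (indicator (A i)) y) \<partial>M) = emeasure M (A i)" for i
      using int[of "A i"] union.IH[of i] union.hyps(2) avg_indicator_bounds[of _ n "A i"]
      by (subst nn_integral_eq_integral) (auto simp: space emeasure_eq_measure)
    have "ennreal (avg n (indicator (\<Union>i. A i)) y) = (\<Sum>i. ennreal (avg n (indicator (A i)) y))"
      if "y \<in> space M" for y
    proof -
      have "(\<lambda>i. avg n (indicator (A i)) y) sums avg n (indicator (\<Union>i. A i)) y"
        unfolding gibbs_avg_def using union.hyps(1)
        by (intro sums_sum sums_mult2 indicator_sums) (auto simp: disjoint_family_on_def)
      then show ?thesis
        using that avg_indicator_bounds(1)[of y n]
        by (intro suminf_ennreal_eq[symmetric]) (simp_all add: space)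
    qed
    then have "(\<integral>\<^sup>+y. ennreal (avg n (indicator (\<Union>i. A i)) y) \<partial>M)
        = (\<integral>\<^sup>+y. (\<Sum>i. ennreal (avg n (indicator (A i)) y)) \<partial>M)"
      by (rule nn_integral_cong)
    also have "\<dots> = (\<Sum>i. \<integral>\<^sup>+y. ennreal (avg n (indicator (A i)) y) \<partial>M)"
      using union.hyps(2)
      by (intro nn_integral_suminf measurable_compose[OF borel_measurable_integrable[OF int] measurable_ennreal])
        auto
    also have "\<dots> = emeasure M (\<Union>i. A i)"
      unfolding em using union.hyps inM by (intro suminf_emeasure) auto
    finally have "(\<integral>\<^sup>+y. ennreal (avg n (indicator (\<Union>i. A i)) y) \<partial>M) = emeasure M (\<Union>i. A i)" .
    moreover have nonneg: "AE y in M. 0 \<le> avg n (indicator (\<Union>i. A i)) y"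
      using avg_indicator_bounds(1) by (intro AE_I2) (simp add: space)
    ultimately show ?case
      using integral_nonneg_AE[OF nonneg]
      by (simp add: nn_integral_eq_integral[OF int[OF U] nonneg] emeasure_eq_measure)
  qed
qed

text \<open>Integrating the conditional probabilities shows that a Gibbs measure is invariant under all kernels,
  and on a cylinder event these converge uniformly to \<^const>\<open>limit_avg\<close>; this determines the measure.
  Conversely \<^const>\<open>limit_avg\<close> is invariant under the kernels by consistency, and by properness
  invariance on the events \<open>T \<inter> F\<close> with \<open>T\<close> in the tail is the defining property of the
  conditional probability of \<open>F\<close>.\<close>

lemma DLR_Gibbs_eq:
  "DLR_Gibbs f = {M. prob_space M \<and> sets M = sets Borel_Omega \<and>
     (\<forall>A\<in>cylinders. measure M A = limit_avg (indicator A))}"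
proof (intro equalityI subsetI)
  fix M assume "M \<in> DLR_Gibbs f"
  then have M: "prob_space M" "sets M = sets Borel_Omega" and "M \<in> prob_measures"
    and DLR: "\<And>F n. F \<in> sets Borel_Omega \<Longrightarrow> 1 \<le> n \<Longrightarrow>
      AE y in M. real_cond_exp M (tail_algebra n) (indicator F) y = avg n (indicator F) y"
    by (auto simp: DLR_Gibbs_def prob_measures_def kernel_eq_gibbs_avg)
  interpret prob_space M by fact
  have space: "space M = Omega"
    using sets_eq_imp_space_eq[OF M(2)] by (simp only: space_Borel_Omega)
  have "measure M A = limit_avg (indicator A)" if A: "A \<in> cylinders" for A
  proof -
    have AB: "A \<in> sets Borel_Omega" using A by (rule cylinder_in_Borel)
    then have AM: "A \<in> sets M" by (simp add: M(2))
    have eq: "measure M A = (\<integral>y. avg n (indicator A) y \<partial>M)" if n: "1 \<le> n" for n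
    proof -
      interpret finite_measure_subalgebra M "tail_algebra n"
        by standard (rule subalgebra_tail_algebra[OF \<open>M \<in> prob_measures\<close>])
      have "integrable M (indicator A :: _ \<Rightarrow> real)"
        using AM by (rule integrable_real_indicator) (simp add: emeasure_eq_measure)
      from real_cond_exp_int[OF this]
      have "measure M A = (\<integral>y. real_cond_exp M (tail_algebra n) (indicator A) y \<partial>M)"
        using AM sets.sets_into_space[OF AM] by (simp add: Int_absorb2)
      also have "\<dots> = (\<integral>y. avg n (indicator A) y \<partial>M)"
        using DLR[OF AB n] real_cond_exp_int(1)[OF \<open>integrable M (indicator A)\<close>]
          avg_indicator_integrable[OF M AB, of n]
        by (intro integral_cong_AE) auto
      finally show ?thesis .
    qed
    have "\<bar>measure M A - limit_avg (indicator A)\<bar> \<le> 0 + e" if "0 < e" for e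
    proof -
      obtain m where m: "osc_le (avg m (indicator A)) e"
        using oscillation_tends_to_zero[OF unif_cont_cylinder[OF A] \<open>0 < e\<close>] by blast
      have uc: "unif_cont (indicator A)" using A by (rule unif_cont_cylinder)
      have "\<bar>avg (max 1 m) (indicator A) y - limit_avg (indicator A)\<bar> \<le> e"
        if y: "y \<in> Omega" for y
      proof -
        have "osc_le (avg (max 1 m) (indicator A)) e"
          using osc_le_gibbs_avg_mono[OF m] by simp
        from gibbs_avg_limit_dist[OF uc this y] show ?thesis by (simp add: abs_minus_commute)
      qed
      then have "\<bar>(\<integral>y. avg (max 1 m) (indicator A) y \<partial>M) - (\<integral>y. limit_avg (indicator A) \<partial>M)\<bar> \<le> e"
        using avg_indicator_integrable[OF M AB] by (intro integral_dist[OF M]) auto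
      then show ?thesis using eq[of "max 1 m"] by (simp add: prob_space)
    qed
    then have "\<bar>measure M A - limit_avg (indicator A)\<bar> \<le> 0" by (rule field_le_epsilon)
    then show ?thesis by simp
  qed
  then show "M \<in> {M. prob_space M \<and> sets M = sets Borel_Omega \<and>
     (\<forall>A\<in>cylinders. measure M A = limit_avg (indicator A))}" using M by blast
next
  fix M assume "M \<in> {M. prob_space M \<and> sets M = sets Borel_Omega \<and>
     (\<forall>A\<in>cylinders. measure M A = limit_avg (indicator A))}"
  then have M: "prob_space M" "sets M = sets Borel_Omega"
    and cyl: "\<And>A. A \<in> cylinders \<Longrightarrow> measure M A = limit_avg (indicator A)" by auto
  then have pm: "M \<in> prob_measures" by (simp add: prob_measures_def)
  interpret prob_space M by fact
  have space: "space M = Omega"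
    using sets_eq_imp_space_eq[OF M(2)] by (simp only: space_Borel_Omega)
  have invariant: "(\<integral>y. avg n (indicator F) y \<partial>M) = measure M F" if "F \<in> sets Borel_Omega" for n F
  proof (rule integral_avg_indicator[OF M _ that])
    fix A assume A: "A \<in> cylinders"
    then have "(\<integral>y. avg n (indicator A) y \<partial>M) = limit_avg (avg n (indicator A))"
      by (intro integral_eq_limit_avg[OF M cyl] unif_cont_gibbs_avg unif_cont_cylinder)
    then show "(\<integral>y. avg n (indicator A) y \<partial>M) = measure M A"
      using A by (simp add: limit_avg_invariant unif_cont_cylinder cyl)
  qed
  have "AE y in M. real_cond_exp M (tail_algebra n) (indicator F) y = avg n (indicator F) y"
    if F: "F \<in> sets Borel_Omega" for F n
  proof -
    interpret finite_measure_subalgebra M "tail_algebra n"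
      by standard (rule subalgebra_tail_algebra[OF pm])
    show ?thesis
    proof (rule real_cond_exp_charact)
      show "integrable M (indicator F :: _ \<Rightarrow> real)"
        using F by (intro integrable_real_indicator) (simp_all add: M(2) emeasure_eq_measure)
      show "integrable M (avg n (indicator F))" by (rule avg_indicator_integrable[OF M F])
      show "avg n (indicator F) \<in> borel_measurable (tail_algebra n)"
        by (rule avg_indicator_measurable[OF F])
      fix T assume T: "T \<in> sets (tail_algebra n)"
      then have TB: "T \<in> sets Borel_Omega" using sets_tail_algebra_subset by auto
      have "indicator T y * avg n (indicator F) y = avg n (indicator (T \<inter> F)) y"
        if "y \<in> space M" for y
      proof -
        have y: "y \<in> Omega" using that by (simp add: space)
        have "avg n (indicator (T \<inter> F)) y = avg n (\<lambda>x. indicator T y * indicator F x) y"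
          using tail_algebra_fibre[OF T y]
          by (intro gibbs_avg_cong) (auto simp: indicator_def)
        then show ?thesis by (simp add: gibbs_avg_def sum_distrib_left mult.assoc)
      qed
      then have "(\<integral>y\<in>T. avg n (indicator F) y \<partial>M) = (\<integral>y. avg n (indicator (T \<inter> F)) y \<partial>M)"
        unfolding set_lebesgue_integral_def
        by (intro Bochner_Integration.integral_cong) auto
      also have "\<dots> = measure M (T \<inter> F)" using TB F by (intro invariant) auto
      also have "\<dots> = (\<integral>y\<in>T. indicator F y \<partial>M)"
        unfolding set_lebesgue_integral_def using TB F sets.sets_into_space[of F M] M(2)
        by (simp add: indicator_inter_arith[symmetric] Int_absorb2 le_infI2)
      finally show "(\<integral>y\<in>T. indicator F y \<partial>M) = (\<integral>y\<in>T. avg n (indicator F) y \<partial>M)" ..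
    qed
  qed
  then show "M \<in> DLR_Gibbs f"
    using pm by (simp add: DLR_Gibbs_def kernel_eq_gibbs_avg)
qed

theorem unique_DLR_Gibbs: "\<exists>!M. M \<in> DLR_Gibbs f"
proof (rule ex_ex1I)
  show "\<exists>M. M \<in> DLR_Gibbs f"
    unfolding DLR_Gibbs_eq using limit_measure_exists by simp
  fix M N assume "M \<in> DLR_Gibbs f" "N \<in> DLR_Gibbs f"
  then have M: "prob_space M" "sets M = sets Borel_Omega" and N: "prob_space N" "sets N = sets Borel_Omega"
    and eq: "\<And>A. A \<in> cylinders \<Longrightarrow> measure M A = measure N A"
    by (auto simp: DLR_Gibbs_eq)
  interpret M: prob_space M by fact
  interpret N: prob_space N by fact
  interpret algebra Omega cylinders by (rule algebra_cylinders)
  show "M = N"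
  proof (rule measure_eqI_generator_eq[OF Int_stable_cylinders cylinders_Pow, where A = "\<lambda>_. Omega"])
    show "emeasure M A = emeasure N A" if "A \<in> cylinders" for A
      using eq[OF that] by (simp add: M.emeasure_eq_measure N.emeasure_eq_measure)
    show "sets M = sigma_sets Omega cylinders" "sets N = sigma_sets Omega cylinders"
      using M(2) N(2) by (simp_all add: sets_Borel_Omega)
  qed auto
qed

end

section \<open>The long-range Ising potential\<close>

text \<open>With \<open>r = i + p + 1\<close> this is the sum of \<open>(r - p) * r powr (- s)\<close> over \<open>r > p\<close>. It is
  the total strength of the bonds between the half lines \<open>{..n}\<close> and \<open>{n + p<..}\<close> of integers, as
  \<open>r - p\<close> bonds of length \<open>r\<close>, each of weight \<open>r powr (- s)\<close>, join them.\<close>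

definition walters_bound :: "real \<Rightarrow> nat \<Rightarrow> real" where
  "walters_bound s p = (\<Sum>i. real (i + 1) * real (i + p + 1) powr (- s))"

lemma powr_tail_summable:
  assumes "1 < s"
  shows "summable (\<lambda>i. real (i + p + 1) powr (- s))"
proof -
  have "summable (\<lambda>i. real i powr (- s))" using assms by (subst summable_real_powr_iff) simp
  from summable_ignore_initial_segment[OF this, of "p + 1"] show ?thesis by (simp add: add.assoc)
qed

text \<open>The number of bonds of a given length costs one power of the distance. This is where a decay faster than the
  inverse square is needed.\<close>

lemma weighted_powr_le: "real (i + 1) * real (i + p + 1) powr (- s) \<le> real (i + p + 1) powr (- (s - 1))"
proof -
  have "real (i + 1) * real (i + p + 1) powr (- s) \<le> real (i + p + 1) * real (i + p + 1) powr (- s)"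
    by (intro mult_right_mono) auto
  also have "\<dots> = real (i + p + 1) powr (1 + - s)"
    by (subst powr_add) simp
  finally show ?thesis by simp
qed

lemma weighted_powr_summable:
  assumes "2 < s"
  shows "summable (\<lambda>i. real (i + 1) * real (i + p + 1) powr (- s))"
proof (rule summable_comparison_test'[OF powr_tail_summable[of "s - 1" p]])
  show "1 < s - 1" using assms by simp
  show "norm (real (i + 1) * real (i + p + 1) powr (- s)) \<le> real (i + p + 1) powr (- (s - 1))" for i
    using weighted_powr_le[of i p s] by (simp add: abs_mult)
qed

lemma walters_bound_nonneg: "2 < s \<Longrightarrow> 0 \<le> walters_bound s p"
  unfolding walters_bound_def using weighted_powr_summable[of s p] by (intro suminf_nonneg) auto

lemma walters_bound_lim:
  assumes "2 < s"
  shows "walters_bound s \<longlonglongrightarrow> 0"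
proof (rule tendsto_sandwich[where f = "\<lambda>_. 0"])
  have sum: "summable (\<lambda>i. real i powr (- (s - 1)))"
    using assms by (subst summable_real_powr_iff) simp
  have "(\<lambda>p. \<Sum>i. real (i + p) powr (- (s - 1))) \<longlonglongrightarrow> 0"
    by (rule suminf_exist_split2[OF sum])
  from LIMSEQ_Suc[OF this]
  show "(\<lambda>p. \<Sum>i. real (i + p + 1) powr (- (s - 1))) \<longlonglongrightarrow> 0" by (simp add: add.assoc)
  have "walters_bound s p \<le> (\<Sum>i. real (i + p + 1) powr (- (s - 1)))" for p
    unfolding walters_bound_def using assms
    by (intro suminf_le weighted_powr_le weighted_powr_summable powr_tail_summable) linarith+
  then show "\<forall>\<^sub>F p in sequentially. walters_bound s p \<le> (\<Sum>i. real (i + p + 1) powr (- (s - 1)))"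
    by simp
  show "\<forall>\<^sub>F p in sequentially. 0 \<le> walters_bound s p"
    using walters_bound_nonneg[OF assms] by simp
qed simp

text \<open>The bonds of length more than \<open>p\<close> from a single site to one side. The Birkhoff sum adds up such
  contributions of its sites, which therefore telescope.\<close>

lemma walters_bound_diff:
  assumes "2 < s"
  shows "walters_bound s p - walters_bound s (p + 1) = (\<Sum>i. real (i + p + 1) powr (- s))"
proof -
  let ?g = "\<lambda>i. real i * real (i + p + 1) powr (- s)"
  have 1: "summable (\<lambda>i. ?g (Suc i))"
    using weighted_powr_summable[OF assms, of "p + 1"] by (simp add: add_ac)
  then have g: "summable ?g" using summable_Suc_iff[of ?g] by blast
  have "walters_bound s (p + 1) = (\<Sum>i. ?g (Suc i))"
    unfolding walters_bound_def by (simp add: add_ac)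
  also have "\<dots> = suminf ?g" using suminf_split_head[OF g] by simp
  finally have "walters_bound s p - walters_bound s (p + 1)
      = (\<Sum>i. real (i + 1) * real (i + p + 1) powr (- s) - ?g i)"
    unfolding walters_bound_def[of s p]
    by (simp only: suminf_diff[OF weighted_powr_summable[OF assms] g])
  also have "\<dots> = (\<Sum>i. real (i + p + 1) powr (- s))"
    by (simp add: algebra_simps)
  finally show ?thesis .
qed

lemma ising_potential_sums:
  assumes "\<epsilon> > 0" "x \<in> Omega"
  shows "(\<lambda>i. x 1 * x (i + 2) * real (i + 1) powr (- (2 + \<epsilon>))) sums ising_potential \<epsilon> x"
proof -
  let ?h = "\<lambda>n. x 1 * x n / (real n - 1) powr (2 + \<epsilon>)"
  have bij: "bij_betw (\<lambda>i::nat. i + 2) UNIV {2..}"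
    by (rule bij_betw_byWitness[where f' = "\<lambda>n. n - 2"]) auto
  have "(?h has_sum ising_potential \<epsilon> x) {2..}"
    unfolding ising_potential_def using summable_ising[OF assms] by (rule has_sum_infsum)
  then have "((\<lambda>i. ?h (i + 2)) has_sum ising_potential \<epsilon> x) UNIV"
    using has_sum_reindex_bij_betw[OF bij, of ?h] by blast
  then have "(\<lambda>i. ?h (i + 2)) sums ising_potential \<epsilon> x" by (rule has_sum_imp_sums)
  moreover have "?h (i + 2) = x 1 * x (i + 2) * real (i + 1) powr (- (2 + \<epsilon>))" for i
    by (subst powr_minus) (simp add: divide_inverse add_ac)
  ultimately show ?thesis by simp
qed

text \<open>In the series for the potential the bonds inside the common part cancel, and every other bond contributes
  at most twice its strength.\<close>

lemma ising_potential_diff: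
  assumes "\<epsilon> > 0" and x: "x \<in> Omega" and y: "y \<in> Omega" and xy: "agree (q + 1) x y"
  shows "\<bar>ising_potential \<epsilon> x - ising_potential \<epsilon> y\<bar>
      \<le> 2 * (\<Sum>i. real (i + q + 1) powr (- (2 + \<epsilon>)))"
proof -
  let ?c = "\<lambda>i. real (i + 1) powr (- (2 + \<epsilon>))"
  define t where "t i = (x 1 * x (i + 2) - y 1 * y (i + 2)) * ?c i" for i
  have abs1: "\<bar>z i\<bar> = 1" if "z \<in> Omega" "1 \<le> i" for z i
    using Omega_spin[OF that] by (auto simp: spins_def)
  have c: "summable (\<lambda>i. real (i + q + 1) powr (- (2 + \<epsilon>)))"
    using assms(1) by (intro powr_tail_summable) simp
  have "t sums (ising_potential \<epsilon> x - ising_potential \<epsilon> y)"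
    using sums_diff[OF ising_potential_sums[OF assms(1) x] ising_potential_sums[OF assms(1) y]]
    by (simp add: t_def[abs_def] left_diff_distrib)
  moreover have "t i = 0" if "i < q" for i
  proof -
    have "x 1 = y 1" "x (i + 2) = y (i + 2)" using xy that by (auto simp: agree_def)
    then show ?thesis by (simp add: t_def)
  qed
  ultimately have tail: "(\<lambda>i. t (i + q)) sums (ising_potential \<epsilon> x - ising_potential \<epsilon> y)"
    by (subst sums_zero_iff_shift) auto
  have le: "norm (t (i + q)) \<le> 2 * real (i + q + 1) powr (- (2 + \<epsilon>))" for i
  proof -
    have "\<bar>x 1 * x (i + q + 2) - y 1 * y (i + q + 2)\<bar> \<le> \<bar>x 1 * x (i + q + 2)\<bar> + \<bar>y 1 * y (i + q + 2)\<bar>"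
      by (rule abs_triangle_ineq4)
    also have "\<dots> = 2" using x y by (simp add: abs_mult abs1)
    finally have "\<bar>x 1 * x (i + q + 2) - y 1 * y (i + q + 2)\<bar> \<le> 2" .
    then show ?thesis unfolding t_def real_norm_def abs_mult by (intro mult_mono) auto
  qed
  have "norm (\<Sum>i. t (i + q)) \<le> (\<Sum>i. 2 * real (i + q + 1) powr (- (2 + \<epsilon>)))"
    using le summable_mult[OF c, of 2] by (rule norm_suminf_le)
  then show ?thesis
    using sums_unique[OF tail] suminf_mult[OF c, of 2] by simp
qed

text \<open>The \<open>k\<close>-th shift agrees on the first \<open>n + p - k\<close> coordinates, so its contribution is controlled by
  the bonds of one site of length more than \<open>p + (n - Suc k)\<close>. Summing over \<open>k\<close> telescopes to a bound
  in which \<open>n\<close> no longer occurs.\<close>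

lemma ising_birkhoff_sum_diff:
  assumes \<epsilon>: "\<epsilon> > 0" and x: "x \<in> Omega" and y: "y \<in> Omega" and xy: "agree (n + p) x y"
  shows "\<bar>birkhoff_sum n (ising_potential \<epsilon>) x - birkhoff_sum n (ising_potential \<epsilon>) y\<bar>
      \<le> 2 * walters_bound (2 + \<epsilon>) p"
proof -
  let ?T = "\<lambda>q. \<Sum>i. real (i + q + 1) powr (- (2 + \<epsilon>))"
  let ?V = "walters_bound (2 + \<epsilon>)"
  have "\<bar>birkhoff_sum n (ising_potential \<epsilon>) x - birkhoff_sum n (ising_potential \<epsilon>) y\<bar>
      \<le> (\<Sum>k<n. \<bar>ising_potential \<epsilon> ((left_shift ^^ k) x) - ising_potential \<epsilon> ((left_shift ^^ k) y)\<bar>)"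
    unfolding birkhoff_sum_def by (subst sum_subtractf[symmetric]) (rule sum_abs)
  also have "\<dots> \<le> (\<Sum>k<n. 2 * ?T (p + (n - Suc k)))"
  proof (rule sum_mono)
    fix k assume k: "k \<in> {..<n}"
    have "agree (p + (n - Suc k) + 1) ((left_shift ^^ k) x) ((left_shift ^^ k) y)"
      using xy k by (auto simp: agree_def left_shift_funpow)
    then show "\<bar>ising_potential \<epsilon> ((left_shift ^^ k) x) - ising_potential \<epsilon> ((left_shift ^^ k) y)\<bar>
        \<le> 2 * ?T (p + (n - Suc k))"
      by (intro ising_potential_diff \<epsilon> left_shift_funpow_in_Omega x y)
  qed
  also have "\<dots> = 2 * (\<Sum>j<n. ?T (p + j))"
    by (simp only: sum_distrib_left sum.nat_diff_reindex[of "\<lambda>j. 2 * ?T (p + j)" n])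
  also have "(\<Sum>j<n. ?T (p + j)) = (\<Sum>j<n. ?V (p + j) - ?V (p + Suc j))"
    using walters_bound_diff[of "2 + \<epsilon>"] \<epsilon> by (intro sum.cong) auto
  also have "\<dots> = ?V p - ?V (p + n)"
    by (subst sum_lessThan_telescope') simp
  also have "2 * (?V p - ?V (p + n)) \<le> 2 * ?V p"
    using walters_bound_nonneg[of "2 + \<epsilon>" "p + n"] \<epsilon> by simp
  finally show ?thesis .
qed

lemma bounded_distortion_ising:
  assumes "\<epsilon> > 0"
  shows "bounded_distortion (ising_potential \<epsilon>) (\<lambda>p. 2 * walters_bound (2 + \<epsilon>) p)"
proof
  show "(\<lambda>p. 2 * walters_bound (2 + \<epsilon>) p) \<longlonglongrightarrow> 0"
    using assms by (intro tendsto_mult_right_zero walters_bound_lim) simp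
qed (use assms in \<open>rule ising_birkhoff_sum_diff\<close>)

lemma (in bounded_distortion) in_Walters: "f \<in> Walters"
  unfolding Walters_def
proof (rule CollectI, rule tendsto_sandwich)
  have mem: "ereal \<bar>birkhoff_sum n f x - birkhoff_sum n f x\<bar> \<le> variation (n + p) (birkhoff_sum n f)"
    if "x \<in> Omega" for n p x
    unfolding variation_def using that by (intro Sup_upper) blast
  have "0 \<le> variation (1 + p) (birkhoff_sum 1 f)" for p
    using mem[OF plus_config_in_Omega, of 1 p] by (simp add: zero_ereal_def)
  then show "\<forall>\<^sub>F p in sequentially. 0 \<le> (SUP n\<in>{1..}. variation (n + p) (birkhoff_sum n f))"
    by (intro always_eventually allI SUP_upper2[of 1]) auto
  have "variation (n + p) (birkhoff_sum n f) \<le> ereal (d p)" for n p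
    unfolding variation_def
    using distortion[of _ _ n p] by (intro Sup_least) (auto simp: agree_def)
  then show "\<forall>\<^sub>F p in sequentially.
      (SUP n\<in>{1..}. variation (n + p) (birkhoff_sum n f)) \<le> ereal (d p)"
    by (intro always_eventually allI SUP_least)
  show "(\<lambda>p. ereal (d p)) \<longlonglongrightarrow> 0"
    using distortion_lim by (simp add: zero_ereal_def)
qed simp

theorem mainTheorem3:
  fixes \<epsilon> :: real
  assumes "\<epsilon> > 0"
  shows "ising_potential \<epsilon> \<in> Walters \<and> (\<exists>!\<mu>. \<mu> \<in> DLR_Gibbs (ising_potential \<epsilon>))"
proof -
  interpret bounded_distortion "ising_potential \<epsilon>" "\<lambda>p. 2 * walters_bound (2 + \<epsilon>) p"
    using assms by (rule bounded_distortion_ising)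
  show ?thesis using in_Walters unique_DLR_Gibbs by blast
qed

end
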